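(* For all integers $a>0$ and $0 \leq s \leq b$, \[ \sum_{PF\in\mathcal{PF}_{a,b}^{(s)}} q^{\operatorname{coarea}(PF)+\operatorname{dinv}(PF)} = q^{\binom{a+b}{2} - (b-s)a} \begin{bmatrix} a+b \\ a \end{bmatrix}_q \begin{bmatrix} a+b-s-1 \\ a-1 \end{bmatrix}_q \frac{[s+1]_q}{[b+1]_q}. \] When $a=0$, for all $0\le s\le b$, \[ \sum_{PF\in\mathcal{PF}_{0,b}^{(s)}} q^{\operatorname{coarea}(PF)+\operatorname{dinv}(PF)} = q^{\binom{b}{2}}\chi(b=s). \]
   Context: A parking function of size $n$ is a two-line array $PF=\begin{bmatrix} v_1 & \cdots & v_n \\ u_1 & \cdots & u_n\end{bmatrix}$ where $u_1=0$, $0\le u_i\le u_{i-1}+1$ for $i\ge 2$, $(v_1,\dots,v_n)$ is a permutation of $\{1,\dots,n\}$, and $u_i=u_{i-1}+1$ implies $v_i>v_{i-1}$. Car $v_i$ lies on the main diagonal iff $u_i=0$. Define $\operatorname{area}(PF)=\sum_i u_i$, $\operatorname{coarea}(PF)=\binom{n}{2}-\operatorname{area}(PF)$, and $\operatorname{dinv}(PF)=\#\{i<j: u_i=u_j,\ v_i<v_j\}+\#\{i<j: u_i=u_j+1,\ v_i>v_j\}$. The diagonal (reading) word $\sigma(PF)$ is obtained by listing the cars $v_i$ in order of decreasing value of $u_i$, and, among indices with the same value of $u_i$, in decreasing order of the index $i$. For $a+b=n$, cars $1,\dots,a$ are "small" and $a+1,\dots,a+b$ are "big". $\mathcal{PF}_{a,b}^{(s)}$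 is the set of parking functions of size $n$ whose word $\sigma(PF)$ is a shuffle of the words $1\,2\cdots a$ and $(a+1)(a+2)\cdots(a+b)$ and which have exactly $s$ big cars on the main diagonal (any number of small cars). $[m]_q=1+q+\dots+q^{m-1}$, $\begin{bmatrix} m\\ k\end{bmatrix}_q$ is the Gaussian binomial coefficient, and $\chi(P)$ is $1$ if $P$ holds and $0$ otherwise. *)

theory Defs
  imports "HOL-Combinatorics.Multiset_Permutations" "HOL-Computational_Algebra.Computational_Algebra"
begin

text \<open>
  A two-line array with top row \<open>v\<close> (the cars) and bottom row \<open>u\<close> is the pair of lists
  \<open>(v, u)\<close>. List positions start at 0, so the entries \<open>v\<^sub>i\<close> and \<open>u\<^sub>i\<close> of the array are
  \<open>v ! (i - 1)\<close> and \<open>u ! (i - 1)\<close>. The empty array is the unique parking function of size 0.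
\<close>

type_synonym two_line = "nat list \<times> nat list"

definition parking_function :: "nat \<Rightarrow> two_line \<Rightarrow> bool" where
  "parking_function n = (\<lambda>(v, u).
     length u = n \<and>
     v \<in> permutations_of_set {1..n} \<and>
     (n > 0 \<longrightarrow> u ! 0 = 0) \<and>
     (\<forall>i. 1 \<le> i \<and> i < n \<longrightarrow> u ! i \<le> u ! (i - 1) + 1) \<and>
     (\<forall>i. 1 \<le> i \<and> i < n \<and> u ! i = u ! (i - 1) + 1 \<longrightarrow> v ! i > v ! (i - 1)))"

definition area :: "two_line \<Rightarrow> nat" where
  "area = (\<lambda>(v, u). sum_list u)"

text \<open>
  The subtraction does not truncate on parking functions: see \<open>area_le\<close> below.
\<close>

definition coarea :: "two_line \<Rightarrow> nat" where
  "coarea PF = (length (fst PF) choose 2) - area PF"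

definition dinv :: "two_line \<Rightarrow> nat" where
  "dinv = (\<lambda>(v, u).
     card {(i, j). i < j \<and> j < length u \<and> u ! i = u ! j \<and> v ! i < v ! j} +
     card {(i, j). i < j \<and> j < length u \<and> u ! i = u ! j + 1 \<and> v ! i > v ! j})"

text \<open>
  \<open>sort_key\<close> is stable, so the reversed list has the positions in decreasing order of their
  \<open>u\<close>-value and, for equal \<open>u\<close>-values, in decreasing order of the position.
\<close>

definition diagonal_word :: "two_line \<Rightarrow> nat list" where
  "diagonal_word = (\<lambda>(v, u). map (\<lambda>i. v ! i) (rev (sort_key (\<lambda>i. u ! i) [0..<length u])))"

definition big_on_diagonal :: "nat \<Rightarrow> two_line \<Rightarrow> nat" where
  "big_on_diagonal a = (\<lambda>(v, u). card {i. i < length u \<and> u ! i = 0 \<and> v ! i > a})"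

definition PF_set :: "nat \<Rightarrow> nat \<Rightarrow> nat \<Rightarrow> two_line set" where
  "PF_set a b s = {PF. parking_function (a + b) PF \<and>
     diagonal_word PF \<in> shuffles [1..<a + 1] [a + 1..<a + b + 1] \<and>
     big_on_diagonal a PF = s}"

text \<open>
  The indeterminate \<open>q\<close> is an element of the field of fractions of \<open>\<int>[q]\<close>, so that quotients of
  \<open>q\<close>-integers are quotients of polynomials with nonzero denominator.
\<close>

definition q :: "int poly fract" where
  "q = to_fract [:0, 1:]"

definition q_int :: "nat \<Rightarrow> int poly fract" where
  "q_int m = (\<Sum>i<m. q ^ i)"

definition q_fact :: "nat \<Rightarrow> int poly fract" where
  "q_fact m = (\<Prod>i=1..m. q_int i)"

definition q_binomial :: "nat \<Rightarrow> nat \<Rightarrow> int poly fract" where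
  "q_binomial m k = (if k \<le> m then q_fact m / (q_fact k * q_fact (m - k)) else 0)"

lemma parking_function_nth_le:
  assumes "parking_function n (v, u)" "i < n"
  shows "u ! i \<le> i"
  using assms(2)
proof (induction i)
  case 0
  then show ?case using assms(1) by (simp add: parking_function_def)
next
  case (Suc i)
  have "u ! Suc i \<le> u ! i + 1"
    using assms(1) Suc.prems unfolding parking_function_def by force
  then show ?case using Suc by simp
qed

lemma area_le:
  assumes "parking_function n PF"
  shows "area PF \<le> length (fst PF) choose 2"
proof -
  obtain v u where PF: "PF = (v, u)" by force
  have u: "length u = n" and v: "length v = n"
    using assms by (auto simp: PF parking_function_def length_finite_permutations_of_set)
  have "sum_list u = (\<Sum>i<n. u ! i)"
    by (simp add: sum_list_sum_nth u atLeast0LessThan)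
  also have "\<dots> \<le> (\<Sum>i<n. i)"
    using parking_function_nth_le assms PF by (intro sum_mono) auto
  also have "\<dots> = n choose 2"
    by (induction n) (auto simp: numeral_2_eq_2)
  finally show ?thesis by (simp add: area_def PF v)
qed

lemma finite_PF_set: "finite (PF_set a b s)"
proof (rule finite_subset)
  let ?n = "a + b"
  show "PF_set a b s \<subseteq>
      permutations_of_set {1..?n} \<times> {u. set u \<subseteq> {..?n} \<and> length u = ?n}"
  proof
    fix PF assume "PF \<in> PF_set a b s"
    then obtain v u where PF: "PF = (v, u)" and p: "parking_function ?n (v, u)"
      by (cases PF) (auto simp: PF_set_def)
    have "set u \<subseteq> {..?n}"
      using parking_function_nth_le[OF p] p
      by (fastforce simp: in_set_conv_nth parking_function_def)
    then show "PF \<in> permutations_of_set {1..?n} \<times> {u. set u \<subseteq> {..?n} \<and> length u = ?n}"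
      using p by (auto simp: PF parking_function_def)
  qed
  show "finite (permutations_of_set {1..?n} \<times> {u. set u \<subseteq> {..?n} \<and> length u = ?n})"
    by (intro finite_cartesian_product finite_lists_length_eq) auto
qed

end

theory Submission
  imports Defs
begin

text \<open>
  In a parking function whose diagonal word is a shuffle of the two increasing words, the cars of
  one size are ordered by the position in that word, so the labels can be forgotten: only the size
  of each car and its diagonal matter, a diagonal is entered from the one below only by a small car
  followed by a big one, and \<open>dinv\<close> counts pairs of one small and one big car. Such words are
  built up uniquely by inserting cars diagonal by diagonal, each diagonal from left to right. The
  generating function of the ways to complete a partial word depends only on the level \<open>m\<close> of its
  top diagonal, the number \<open>x\<close> of small cars there, and the number \<open>y\<close> of small cars one level
  below and to the right of the last car inserted. The basic case is the generating function of
  everything above a diagonal with \<open>p\<close> small cars, if \<open>a\<close> small and \<open>b\<close> big cars remain; it is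
  \<open>[p] / [b] * q_binomial (a + b - 1) a * q_binomial (p + a + b - 1) (b - 1) / q ^ (b * (a + 1))\<close>
  for \<open>b > 0\<close>. Two applications of the \<open>q\<close>-Vandermonde identity show that it satisfies the
  recursion given by removing one diagonal, and a third gives the product formula.
\<close>

section \<open>Gaussian binomial coefficients and the counting functions\<close>

lemma q_nonzero [simp]: "q \<noteq> 0"
  by (simp add: q_def)

lemma q_int_nonzero [simp]: "q_int (Suc m) \<noteq> 0"
proof
  assume "q_int (Suc m) = 0"
  moreover have "to_fract ([:0, 1:] ^ i :: int poly) = q ^ i" for i
    unfolding q_def by (induction i) (simp_all only: power_0 to_fract_1 power_Suc to_fract_mult)
  then have "q_int k = to_fract (\<Sum>i<k. [:0, 1:] ^ i)" for k
    unfolding q_int_def by (induction k) simp_all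
  ultimately have "(\<Sum>i<Suc m. [:0, 1:] ^ i :: int poly) = 0"
    by (simp only: to_fract_eq_0_iff)
  \<comment> \<open>At 1 this polynomial has the value \<open>Suc m\<close>, so it is not the zero
    polynomial.\<close>
  then have "poly (\<Sum>i<Suc m. [:0, 1:] ^ i :: int poly) 1 = 0"
    by simp
  then show False
    by (simp add: poly_sum del: sum.lessThan_Suc)
qed

lemma q_int_0 [simp]: "q_int 0 = 0"
  by (simp add: q_int_def)

lemma q_int_add: "q_int (m + n) = q_int m + q ^ m * q_int n"
  by (induction n) (simp_all add: q_int_def algebra_simps power_add)

lemma q_int_1 [simp]: "q_int (Suc 0) = 1"
  by (simp add: q_int_def)

lemma q_fact_0 [simp]: "q_fact 0 = 1"
  by (simp add: q_fact_def)

lemma q_fact_Suc: "q_fact (Suc m) = q_fact m * q_int (Suc m)"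
  by (simp add: q_fact_def)

lemma q_fact_nonzero [simp]: "q_fact m \<noteq> 0"
  by (induction m) (simp_all add: q_fact_Suc)

text \<open>Indexing by the two parts makes symmetry an exchange of arguments and removes the side
  condition \<open>k \<le> m\<close> of \<open>q_binomial\<close>.\<close>

definition gauss :: "nat \<Rightarrow> nat \<Rightarrow> int poly fract" where
  "gauss i j = q_binomial (i + j) j"

lemma gauss_eq: "gauss i j = q_fact (i + j) / (q_fact i * q_fact j)"
  by (simp add: gauss_def q_binomial_def field_simps)

lemma gauss_commute: "gauss i j = gauss j i"
  by (simp add: gauss_eq add.commute mult.commute)

lemma gauss_0 [simp]: "gauss i 0 = 1" "gauss 0 j = 1"
  by (simp_all add: gauss_eq)

lemma gauss_Suc_left: "gauss (Suc i) j * q_int (Suc i) = gauss i (Suc j) * q_int (Suc j)"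
  by (simp add: gauss_eq q_fact_Suc field_simps)

lemma gauss_Suc_Suc: "gauss (Suc i) (Suc j) = gauss i (Suc j) + q ^ Suc i * gauss (Suc i) j"
proof -
  have "q_int (Suc (Suc (i + j))) = q_int (Suc i) + q ^ Suc i * q_int (Suc j)"
    using q_int_add[of "Suc i" "Suc j"] by simp
  then show ?thesis
    by (simp add: gauss_eq q_fact_Suc divide_simps) (simp add: algebra_simps)
qed

lemma gauss_Suc_Suc': "gauss (Suc i) (Suc j) = gauss (Suc i) j + q ^ Suc j * gauss i (Suc j)"
  using gauss_Suc_Suc[of j i] by (simp add: gauss_commute)

text \<open>These are the coefficients of z^N in 1/(z;q)_(\<beta>+1) * 1/(q^(\<beta>+1)
  z;q)_(\<alpha>+1) = 1/(z;q)_(\<alpha>+\<beta>+2). The proof avoids power series and applies the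
  q-Pascal rule to the factor with \<alpha>.\<close>

lemma gauss_vandermonde:
  "(\<Sum>j\<le>N. q ^ (Suc \<beta> * j) * gauss \<alpha> j * gauss \<beta> (N - j)) = gauss (Suc (\<alpha> + \<beta>)) N"
proof (induction "\<alpha> + N" arbitrary: \<alpha> N rule: less_induct)
  case less
  show ?case
  proof (cases N)
    case 0
    then show ?thesis by simp
  next
    case (Suc M)
    have shift: "(\<Sum>j\<le>Suc M. q ^ (Suc \<beta> * j) * f j * gauss \<beta> (Suc M - j)) =
        f 0 * gauss \<beta> (Suc M) +
        q ^ Suc \<beta> * (\<Sum>j\<le>M. q ^ (Suc \<beta> * j) * f (Suc j) * gauss \<beta> (M - j))" for f
      unfolding sum.atMost_Suc_shift by (simp add: sum_distrib_left power_add algebra_simps)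
    show ?thesis
    proof (cases \<alpha>)
      case 0
      have IH: "(\<Sum>j\<le>M. q ^ (Suc \<beta> * j) * gauss 0 j * gauss \<beta> (M - j)) = gauss (Suc (0 + \<beta>)) M"
        by (rule less) (use Suc 0 in simp)
      show ?thesis
        unfolding Suc 0 shift using IH by (simp add: gauss_Suc_Suc)
    next
      case (Suc \<gamma>)
      note \<gamma> = this
      have IH1: "(\<Sum>j\<le>Suc M. q ^ (Suc \<beta> * j) * gauss \<gamma> j * gauss \<beta> (Suc M - j)) =
          gauss (Suc (\<gamma> + \<beta>)) (Suc M)"
        by (rule less) (use \<open>N = Suc M\<close> \<gamma> in simp)
      have IH2: "(\<Sum>j\<le>M. q ^ (Suc \<beta> * j) * gauss (Suc \<gamma>) j * gauss \<beta> (M - j)) =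
          gauss (Suc (Suc \<gamma> + \<beta>)) M"
        by (rule less) (use \<open>N = Suc M\<close> \<gamma> in simp)
      have "(\<Sum>j\<le>Suc M. q ^ (Suc \<beta> * j) * gauss (Suc \<gamma>) j * gauss \<beta> (Suc M - j)) =
          gauss (Suc (\<gamma> + \<beta>)) (Suc M) + q ^ Suc \<beta> * (q ^ Suc \<gamma> * gauss (Suc (Suc \<gamma> + \<beta>)) M)"
        unfolding shift IH1[symmetric] IH2[symmetric]
        by (simp add: gauss_Suc_Suc[of \<gamma>] sum.distrib sum_distrib_left algebra_simps)
      also have "\<dots> = gauss (Suc (Suc \<gamma> + \<beta>)) (Suc M)"
        using gauss_Suc_Suc[of "Suc (\<gamma> + \<beta>)" M] by (simp add: power_add mult_ac)
      finally show ?thesis by (simp add: \<open>N = Suc M\<close> \<gamma>)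
    qed
  qed
qed

text \<open>A hockey-stick identity: for \<open>x > 0\<close> the value is
  \<open>gauss (x - 1) (Suc r)\<close>. The quotient form also covers the empty sum at
  \<open>x = 0\<close>.\<close>

lemma sum_gauss: "(\<Sum>y<x. q ^ y * gauss y r) = q_int x / q_int (Suc r) * gauss x r"
proof (induction x)
  case (Suc x)
  have "q_int (Suc x) * gauss (Suc x) r = q_int (Suc r) * gauss x (Suc r)" for x
    using gauss_Suc_left[of x r] by (simp add: mult.commute)
  then have *: "q_int (Suc x) / q_int (Suc r) * gauss (Suc x) r = gauss x (Suc r)" for x
    by simp
  show ?case
  proof (cases x)
    case 0
    then show ?thesis using gauss_Suc_left[of 0 r] by simp
  next
    case (Suc z)
    then show ?thesis
      using Suc.IH unfolding sum.lessThan_Suc Suc * by (simp add: gauss_Suc_Suc)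
  qed
qed simp

lemma sum_gauss_atMost: "(\<Sum>y'\<le>y. q ^ y' * gauss y' r) = gauss y (Suc r)"
  using gauss_Suc_left[of y r] unfolding lessThan_Suc_atMost[symmetric] sum_gauss
  by (simp add: mult.commute)

section \<open>The generating function above a diagonal\<close>

fun H :: "nat \<Rightarrow> nat \<Rightarrow> nat \<Rightarrow> int poly fract" where
  "H p a 0 = of_bool (a = 0)"
| "H p a (Suc b) =
     q_int p / q_int (Suc b) * gauss a b * gauss (p + a) b / q ^ (Suc b * Suc a)"

text \<open>Since \<open>p + (Suc a - p) = Suc a\<close>, one Gaussian factor of \<open>H\<close>
  does not depend on \<open>p\<close>, and \<open>p = 0\<close> contributes nothing. For
  \<open>p = Suc j\<close>, absorbing \<open>q_int p\<close> into \<open>gauss p r\<close> leaves a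
  q-Vandermonde sum over \<open>j\<close>.\<close>

lemma H_sum:
  "(\<Sum>p\<le>Suc a. gauss p r * H p (Suc a - p) (Suc d)) =
     q_int (Suc r) / q_int (Suc d) * gauss (Suc a) d * gauss a (Suc (Suc (r + d))) / q ^ (Suc d * Suc a)"
proof -
  have "gauss (Suc j) r * H (Suc j) (Suc a - Suc j) (Suc d) =
      q_int (Suc r) / q_int (Suc d) * gauss (Suc a) d / q ^ (Suc d * Suc a) *
      (q ^ (Suc d * j) * gauss (Suc r) j * gauss d (a - j))" if "j \<le> a" for j
  proof -
    have "Suc a = Suc (a - j) + j"
      using that by simp
    then have "q ^ (Suc d * Suc a) = q ^ (Suc d * Suc (a - j)) * q ^ (Suc d * j)"
      by (metis distrib_left power_add)
    moreover have "gauss (Suc j) r * q_int (Suc j) = gauss (Suc r) j * q_int (Suc r)"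
      using gauss_Suc_left[of j r] by (simp add: gauss_commute)
    ultimately have "gauss (Suc j) r * q_int (Suc j) * gauss (Suc a) d * gauss (a - j) d
        / (q_int (Suc d) * q ^ (Suc d * Suc (a - j))) =
      gauss (Suc r) j * q_int (Suc r) * gauss (Suc a) d * gauss d (a - j)
        / (q_int (Suc d) * q ^ (Suc d * Suc a)) * q ^ (Suc d * j)"
      by (simp add: gauss_commute)
    then show ?thesis
      using that by (simp add: mult_ac)
  qed
  then have "(\<Sum>p\<le>Suc a. gauss p r * H p (Suc a - p) (Suc d)) =
      q_int (Suc r) / q_int (Suc d) * gauss (Suc a) d / q ^ (Suc d * Suc a) *
      (\<Sum>j\<le>a. q ^ (Suc d * j) * gauss (Suc r) j * gauss d (a - j))"
    unfolding sum.atMost_Suc_shift sum_distrib_left by (simp del: H.simps(2)) simp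
  then show ?thesis
    unfolding gauss_vandermonde by (simp add: gauss_commute)
qed

text \<open>The next diagonal receives \<open>Suc r\<close> big and \<open>p\<close> small cars and
  begins with a big one, hence \<open>gauss p r\<close>. The factor in \<open>x\<close> places the
  big cars relative to the \<open>x\<close> small cars below, and the division raises all remaining
  cars by one level. A new diagonal needs a big car, which is why \<open>H\<close> without big cars
  is 1 or 0.\<close>

lemma H_rec:
  "H x a (Suc b) = (\<Sum>r\<le>b. q_int x / q_int (Suc r) * gauss x r *
     (\<Sum>p\<le>a. gauss p r * H p (a - p) (b - r))) / q ^ (a + Suc b)"
proof -
  have inner0: "(\<Sum>p\<le>a. gauss p b * H p (a - p) 0) = gauss a b" for a
  proof -
    have "(\<Sum>p\<le>a. gauss p b * H p (a - p) 0) = (\<Sum>p\<le>a. if p = a then gauss a b else 0)"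
      by (rule sum.cong) auto
    then show ?thesis by simp
  qed
  show ?thesis
  proof (cases a)
    case 0
    \<comment> \<open>With no small car left, all big cars lie on one diagonal:
      \<open>H 0 0 (b - r)\<close> vanishes unless \<open>r = b\<close>.\<close>
    have "(\<Sum>r\<le>b. q_int x / q_int (Suc r) * gauss x r * (\<Sum>p\<le>a. gauss p r * H p (a - p) (b - r)))
      = (\<Sum>r\<le>b. if r = b then q_int x / q_int (Suc b) * gauss x b else 0)"
    proof (rule sum.cong)
      fix r assume "r \<in> {..b}"
      then show "q_int x / q_int (Suc r) * gauss x r * (\<Sum>p\<le>a. gauss p r * H p (a - p) (b - r)) =
        (if r = b then q_int x / q_int (Suc b) * gauss x b else 0)"
        by (cases "b - r") (auto simp: 0)
    qed simp
    then show ?thesis by (simp add: 0)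
  next
    case (Suc c)
    \<comment> \<open>In this form \<open>q_int (Suc r)\<close> cancels the outer denominator, and
      the rest of the dependence on \<open>r\<close> is that of a second q-Vandermonde sum.\<close>
    have inner: "(\<Sum>p\<le>a. gauss p r * H p (a - p) (b - r)) =
        q_int (Suc r) / q_int (Suc b) * gauss a b / q ^ (b * a) *
        (q ^ (Suc c * r) * gauss c (b - r))"
      if r: "r \<le> b" for r
    proof (cases "b - r")
      case 0
      then have "r = b" using r by simp
      then show ?thesis using inner0[of a] by (simp add: Suc mult.commute)
    next
      case (Suc d)
      then have b: "b = Suc (r + d)" using r by simp
      have g: "gauss (Suc c) d = gauss c (Suc d) * q_int (Suc d) / q_int (Suc c)"
        "gauss c (Suc b) = gauss (Suc c) b * q_int (Suc c) / q_int (Suc b)"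
        using gauss_Suc_left[of c d] gauss_Suc_left[of c b] by (simp_all add: field_simps)
      have "b * Suc c = Suc d * Suc c + Suc c * r"
        by (simp add: b algebra_simps)
      then have p: "q ^ (b * Suc c) = q ^ (Suc d * Suc c) * q ^ (Suc c * r)"
        by (simp only: power_add)
      have "(\<Sum>p\<le>a. gauss p r * H p (a - p) (b - r)) =
        q_int (Suc r) / q_int (Suc d) * gauss (Suc c) d * gauss c (Suc b) / q ^ (Suc d * Suc c)"
        unfolding \<open>a = Suc c\<close> Suc H_sum by (simp add: b)
      also have "\<dots> = q_int (Suc r) / q_int (Suc b) * gauss a b / q ^ (b * a) *
        (q ^ (Suc c * r) * gauss c (b - r))"
        unfolding g \<open>a = Suc c\<close> Suc p by (simp add: mult_ac)
      finally show ?thesis .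
    qed
    have "(\<Sum>r\<le>b. q_int x / q_int (Suc r) * gauss x r * (\<Sum>p\<le>a. gauss p r * H p (a - p) (b - r))) =
       (\<Sum>r\<le>b. q_int x / q_int (Suc b) * gauss a b / q ^ (b * a) *
         (q ^ (Suc c * r) * gauss x r * gauss c (b - r)))"
      by (rule sum.cong) (simp_all add: inner)
    also have "\<dots> = q_int x / q_int (Suc b) * gauss a b / q ^ (b * a) *
         (\<Sum>r\<le>b. q ^ (Suc c * r) * gauss x r * gauss c (b - r))"
      by (simp only: sum_distrib_left)
    finally show ?thesis
      unfolding gauss_vandermonde by (simp add: Suc power_add mult_ac)
  qed
qed


section \<open>Recursions for adding one car\<close>

text \<open>
  \<open>U x y a b\<close> counts the completions of a partial word whose top diagonal, taken as level 0, has
  state \<open>(x, y)\<close>: \<open>p\<close> small and \<open>r\<close> big cars are still added to that diagonal. \<open>Z\<close> is the variant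
  for the main diagonal, where \<open>y = 0\<close> and the number \<open>s\<close> of big cars to be added is prescribed.
\<close>

definition U :: "nat \<Rightarrow> nat \<Rightarrow> nat \<Rightarrow> nat \<Rightarrow> int poly fract" where
  "U x y a b =
     (\<Sum>r\<le>b. \<Sum>p\<le>a. q ^ (x * r) * gauss p r * gauss y r * H (x + p) (a - p) (b - r))"

definition Z :: "nat \<Rightarrow> nat \<Rightarrow> nat \<Rightarrow> nat \<Rightarrow> int poly fract" where
  "Z x a b s = (if s \<le> b then
     \<Sum>p\<le>a. q ^ (x * s) * gauss p s * H (x + p) (a - p) (b - s) else 0)"

lemma U_conv_Z: "U x y a b = (\<Sum>r\<le>b. gauss y r * Z x a b r)"
  unfolding U_def by (intro sum.cong refl) (simp add: Z_def sum_distrib_left mult_ac)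

text \<open>Here \<open>y\<close> is the number of small cars to the right of the first big car on
  the new diagonal. Each of them forms a \<open>dinv\<close> pair with that big car, which gives
  \<open>q ^ y\<close>.\<close>

lemma H_conv_U:
  "H x a (Suc b) = (\<Sum>y<x. q ^ y * U 0 y a b) / q ^ (a + Suc b)"
proof -
  have "(\<Sum>y<x. q ^ y * U 0 y a b) =
      (\<Sum>r\<le>b. (\<Sum>y<x. q ^ y * gauss y r) * (\<Sum>p\<le>a. gauss p r * H p (a - p) (b - r)))"
    unfolding U_conv_Z sum_distrib_left[of "q ^ _"]
    by (subst sum.swap) (simp add: Z_def sum_distrib_right mult_ac)
  then show ?thesis
    by (simp only: H_rec sum_gauss)
qed

text \<open>The q-Pascal rule for \<open>gauss p r\<close>, read as a choice of the next car in the
  row: it is small or big. For \<open>r = 0\<close> the term \<open>p = 0\<close> means that the row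
  is finished.\<close>

lemma row_rec:
  assumes "r > 0 \<or> a > 0"
  shows "(\<Sum>p\<le>a. q ^ (x * r) * gauss p r * H (x + p) (a - p) c) =
    (if a = 0 then 0
     else \<Sum>p\<le>a - 1. q ^ (Suc x * r) * gauss p r * H (Suc x + p) (a - 1 - p) c) +
    (if r = 0 then H x a c
     else q ^ x * (\<Sum>p\<le>a. q ^ (x * (r - 1)) * gauss p (r - 1) * H (x + p) (a - p) c))"
proof (cases r)
  case 0
  then obtain a' where "a = Suc a'" using assms gr0_implies_Suc by auto
  then show ?thesis
    unfolding 0 by (simp only: sum.atMost_Suc_shift) simp
next
  case (Suc r')
  show ?thesis
  proof (cases a)
    case 0
    then show ?thesis by (simp add: Suc power_add)
  next
    case (Suc a')
    show ?thesis
      unfolding Suc \<open>r = Suc r'\<close>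
      by (simp only: sum.atMost_Suc_shift gauss_Suc_Suc')
        (simp add: sum.distrib sum_distrib_left power_add algebra_simps)
  qed
qed

lemma Z_rec:
  assumes "a + b > 0"
  shows "Z x a b s =
    (if a = 0 then 0 else Z (Suc x) (a - 1) b s) +
    (if b = 0 \<or> s = 0 then 0 else q ^ x * Z x a (b - 1) (s - 1)) +
    (if s = 0 \<and> b > 0 then (\<Sum>y<x. q ^ y * U 0 y a (b - 1)) / q ^ (a + b) else 0)"
proof (cases "s \<le> b")
  case True
  then have "s > 0 \<or> a > 0 \<or> s = 0 \<and> a = 0 \<and> b > 0" using assms by auto
  then show ?thesis
  proof (elim disjE)
    assume "s > 0"
    then show ?thesis
      using True row_rec[of s a x "b - s"] by (auto simp: Z_def)
  next
    assume "a > 0"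
    then show ?thesis
      using True row_rec[of s a x "b - s"] H_conv_U[of x a "b - 1"] by (cases b) (auto simp: Z_def)
  next
    assume "s = 0 \<and> a = 0 \<and> b > 0"
    then show ?thesis
      using H_conv_U[of x a "b - 1"] by (cases b) (auto simp: Z_def)
  qed
qed (auto simp: Z_def)

text \<open>The terms stand for the three kinds of next car: small on the top diagonal, big on the
  top diagonal, big on a new diagonal. A big car on the top diagonal leaves \<open>y'\<close> small
  cars of the diagonal below to its right, and the hockey-stick sum turns
  \<open>gauss y (Suc r)\<close> into a sum over \<open>y'\<close>.\<close>

lemma U_rec:
  assumes "a + b > 0"
  shows "U x y a b =
    (if a = 0 then 0 else U (Suc x) y (a - 1) b) +
    (if b = 0 then 0 else (\<Sum>y'\<le>y. q ^ (x + y') * U x y' a (b - 1)) +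
      (\<Sum>y'<x. q ^ y' * U 0 y' a (b - 1)) / q ^ (a + b))"
proof -
  have 1: "(\<Sum>r\<le>b. gauss y r * (if a = 0 then 0 else Z (Suc x) (a - 1) b r)) =
      (if a = 0 then 0 else U (Suc x) y (a - 1) b)"
    by (simp add: U_conv_Z)
  have 2: "(\<Sum>r\<le>b. gauss y r * (if b = 0 \<or> r = 0 then 0 else q ^ x * Z x a (b - 1) (r - 1))) =
      (if b = 0 then 0 else \<Sum>y'\<le>y. q ^ (x + y') * U x y' a (b - 1))"
  proof (cases b)
    case (Suc c)
    have "(\<Sum>r\<le>b. gauss y r * (if b = 0 \<or> r = 0 then 0 else q ^ x * Z x a (b - 1) (r - 1))) =
        (\<Sum>r\<le>c. gauss y (Suc r) * (q ^ x * Z x a c r))"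
      unfolding Suc by (simp only: sum.atMost_Suc_shift) simp
    also have "\<dots> = (\<Sum>r\<le>c. \<Sum>y'\<le>y. q ^ (x + y') * (gauss y' r * Z x a c r))"
      unfolding sum_gauss_atMost[symmetric] sum_distrib_right
      by (simp add: power_add mult_ac)
    also have "\<dots> = (\<Sum>y'\<le>y. q ^ (x + y') * U x y' a c)"
      unfolding U_conv_Z sum_distrib_left by (rule sum.swap)
    finally show ?thesis by (simp add: Suc)
  qed simp
  have 3: "(\<Sum>r\<le>b. gauss y r * (if r = 0 \<and> b > 0 then (\<Sum>y<x. q ^ y * U 0 y a (b - 1)) / q ^ (a + b) else 0)) =
      (if b = 0 then 0 else (\<Sum>y'<x. q ^ y' * U 0 y' a (b - 1)) / q ^ (a + b))"
  proof (cases b)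
    case (Suc c)
    then show ?thesis
      by (simp only: sum.atMost_Suc_shift) simp
  qed simp
  have "U x y a b = (\<Sum>r\<le>b. gauss y r * (if a = 0 then 0 else Z (Suc x) (a - 1) b r) +
     gauss y r * (if b = 0 \<or> r = 0 then 0 else q ^ x * Z x a (b - 1) (r - 1)) +
     gauss y r * (if r = 0 \<and> b > 0 then (\<Sum>y<x. q ^ y * U 0 y a (b - 1)) / q ^ (a + b) else 0))"
    unfolding U_conv_Z[of x y] by (subst Z_rec[OF assms]) (simp only: distrib_left)
  then show ?thesis
    unfolding sum.distrib 1 2 3 by simp
qed

section \<open>Completions at an arbitrary level\<close>

text \<open>
  The remaining numbers of cars are integers because a partial word may already contain too many
  cars of a kind; it then has no completion.
\<close>

definition completions :: "nat \<Rightarrow> nat \<Rightarrow> nat \<Rightarrow> int \<Rightarrow> int \<Rightarrow> int \<Rightarrow> int poly fract" where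
  "completions m x y a b s =
     (if a < 0 \<or> b < 0 \<or> s < 0 then 0
      else if m = 0 then Z x (nat a) (nat b) (nat s)
      else if s = 0 then U x y (nat a) (nat b) / q ^ (m * nat (a + b)) else 0)"

lemma Z_0_0: "Z x 0 0 s = of_bool (s = 0)"
  by (simp add: Z_def)

lemma U_0_0: "U x y 0 0 = 1"
  by (simp add: U_def)

lemma completions_done:
  assumes "a + b = 0"
  shows "completions m x y a b s = of_bool (a = 0 \<and> b = 0 \<and> s = 0)"
  using assms by (auto simp: completions_def Z_0_0 U_0_0)

text \<open>This transfers \<open>Z_rec\<close> and \<open>U_rec\<close> to level \<open>m\<close>:
  the division by \<open>q ^ (m * nat (a + b))\<close> charges \<open>m\<close> levels to every
  remaining car, and one such charge is split off for the new car. On the main diagonal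
  \<open>y = 0\<close>, so the sum over \<open>y'\<close> has one term.\<close>

lemma completions_rec:
  assumes "a + b > 0" "m = 0 \<longrightarrow> y = 0"
  shows "completions m x y a b s =
    completions m (Suc x) y (a - 1) b s / q ^ m +
    (\<Sum>y'\<le>y. q ^ (x + y') / q ^ m * completions m x y' a (b - 1) (s - of_bool (m = 0))) +
    (\<Sum>y'<x. q ^ y' / q ^ Suc m * completions (Suc m) 0 y' a (b - 1) s)"
proof (cases "a < 0 \<or> b < 0 \<or> s < 0")
  case True
  then show ?thesis by (auto simp: completions_def)
next
  case False
  define A B S where "A = nat a" "B = nat b" "S = nat s"
  then have [simp]: "a = int A" "b = int B" "s = int S" using False by auto
  have AB: "A + B > 0" using assms(1) by simp linarith
  have pred [simp]: "int k - 1 < 0 \<longleftrightarrow> k = 0" "nat (int k - 1) = k - 1" for k by auto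
  have n [simp]: "nat (int A + int B) = A + B" "nat (int A - 1 + int B) = A + B - 1"
    "nat (int A + (int B - 1)) = A + B - 1" by auto
  show ?thesis
  proof (cases "m = 0")
    case True
    have "q ^ (A + B) = q * q ^ (A + B - 1)"
      using AB by (metis Suc_pred' power_Suc)
    then show ?thesis
      using True assms(2) Z_rec[OF AB, of x S]
      by (simp add: completions_def sum_divide_distrib mult_ac)
  next
    case False
    have e: "q ^ (m * (A + B)) = q ^ m * q ^ (m * (A + B - 1))"
      "q ^ (Suc m * (A + B)) = q ^ Suc m * q ^ (Suc m * (A + B - 1))"
      using AB by (cases "A + B"; simp add: power_add)+
    \<comment> \<open>The charge for opening a new diagonal, regrouped: the new big car and each of
      the other \<open>A + B - 1\<close> cars pay \<open>Suc m\<close> levels.\<close>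
    have e': "q ^ (m * (A + B)) * q ^ (A + B) = q ^ Suc m * q ^ (Suc m * (A + B - 1))"
      unfolding e(2)[symmetric] by (simp add: power_add)
    show ?thesis
    proof (cases "S = 0")
      case True
      have "U x y A B / q ^ (m * (A + B)) =
        (if A = 0 then 0 else U (Suc x) y (A - 1) B) / q ^ (m * (A + B - 1)) / q ^ m +
        (if B = 0 then 0 else (\<Sum>y'\<le>y. q ^ (x + y') / q ^ m * (U x y' A (B - 1) / q ^ (m * (A + B - 1))))) +
        (if B = 0 then 0 else (\<Sum>y'<x. q ^ y' / q ^ Suc m * (U 0 y' A (B - 1) / q ^ (Suc m * (A + B - 1)))))"
        unfolding U_rec[OF AB] times_divide_times_eq sum_divide_distrib[symmetric] e'[symmetric]
        unfolding e by (simp add: add_divide_distrib mult_ac)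
      then show ?thesis
        using \<open>m \<noteq> 0\<close> True by (auto simp: completions_def mult_ac)
    next
      case False
      \<comment> \<open>Once the main diagonal has been left, it cannot receive the big cars still
        required there.\<close>
      then have "completions m' x' y' a' b' s = 0" if "m' > 0" for m' x' y' a' b'
        using that by (simp add: completions_def)
      then show ?thesis using \<open>m \<noteq> 0\<close> by simp
    qed
  qed
qed

text \<open>The word starts with an empty main diagonal, so \<open>Z\<close> reduces to the inner
  sum of the recursion with \<open>r = s\<close>, which \<open>H_sum\<close> evaluates. For
  \<open>s = b\<close> nothing can lie above the main diagonal.\<close>

lemma completions_start:
  assumes "a > 0" "s \<le> b"
  shows "completions 0 0 0 (int a) (int b) (int s) =
    q_binomial (a + b) a * q_binomial (a + b - s - 1) (a - 1) * (q_int (s + 1) / q_int (b + 1))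
      / q ^ ((b - s) * a)"
proof -
  obtain a' where a: "a = Suc a'" using assms(1) gr0_implies_Suc by auto
  have Z: "completions 0 0 0 (int a) (int b) (int s) = (\<Sum>p\<le>a. gauss p s * H p (a - p) (b - s))"
    using assms by (simp add: completions_def Z_def)
  have b1: "q_binomial (a + b) a = gauss b (Suc a')"
    by (simp add: gauss_def a add.commute)
  have b2: "q_binomial (a + b - s - 1) (a - 1) = gauss (b - s) a'"
    using assms(2) by (simp add: gauss_def a add.commute)
  show ?thesis
  proof (cases "b - s")
    case 0
    have "(\<Sum>p\<le>a. gauss p s * H p (a - p) 0) = (\<Sum>p\<le>a. if p = a then gauss a s else 0)"
      by (rule sum.cong) auto
    then show ?thesis
      using assms(2) 0 unfolding Z b1 b2 by (simp add: a gauss_commute)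
  next
    case (Suc d)
    have g1: "gauss (Suc d) a' = gauss (Suc a') d * q_int (Suc a') / q_int (Suc d)"
      using gauss_Suc_left[of d a'] by (simp add: field_simps gauss_commute)
    have g2: "gauss b (Suc a') = gauss a' (Suc b) * q_int (Suc b) / q_int (Suc a')"
      using gauss_Suc_left[of b a'] by (simp add: field_simps gauss_commute)
    have "Suc (s + d) = b" using Suc by simp
    then show ?thesis
      unfolding Z b1 b2 Suc unfolding a H_sum g1 g2 by (simp add: mult_ac)
  qed
qed

lemma completions_start_0:
  assumes "s \<le> b"
  shows "completions 0 0 0 0 (int b) (int s) = of_bool (b = s)"
  using assms by (cases "b - s") (auto simp: completions_def Z_def)

section \<open>Words of letters with a level\<close>

type_synonym letter = "bool \<times> nat"

text \<open>A letter is the pair of the size of a car (\<^const>\<open>True\<close> for big) and its level.\<close>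

definition step :: "letter \<Rightarrow> letter \<Rightarrow> bool" where
  "step z z' \<longleftrightarrow> snd z' \<le> snd z \<or> \<not> fst z \<and> fst z' \<and> snd z' = Suc (snd z)"

text \<open>
  The first letter is a sentinel: it forces the next letter to have level 0, contributes nothing to
  \<open>dinv\<close> and area, and makes every insertion take place after some letter.
\<close>

definition words :: "nat \<Rightarrow> letter list set" where
  "words k = {w. length w = Suc k \<and> hd w = (True, 0) \<and> successively step w}"

definition dpair :: "letter \<Rightarrow> letter \<Rightarrow> bool" where
  "dpair z z' \<longleftrightarrow> \<not> fst z \<and> fst z' \<and> snd z = snd z' \<or> fst z \<and> \<not> fst z' \<and> snd z = Suc (snd z')"

fun word_dinv :: "letter list \<Rightarrow> nat" where
  "word_dinv [] = 0"
| "word_dinv (z # w) = length (filter (dpair z) w) + word_dinv w"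

definition weight :: "letter list \<Rightarrow> int poly fract" where
  "weight w = q ^ word_dinv w / q ^ sum_list (map snd w)"

lemma word_dinv_insert:
  "word_dinv (xs @ z # ys) =
     word_dinv (xs @ ys) + length (filter (\<lambda>x. dpair x z) xs) + length (filter (dpair z) ys)"
  by (induction xs) auto

lemma weight_insert:
  "weight (xs @ z # ys) = weight (xs @ ys) *
     (q ^ (length (filter (\<lambda>x. dpair x z) xs) + length (filter (dpair z) ys)) / q ^ snd z)"
  by (simp add: weight_def word_dinv_insert power_add mult_ac)

definition below_count :: "letter list \<Rightarrow> nat \<Rightarrow> nat" where
  "below_count w m = (case m of 0 \<Rightarrow> 0 | Suc l \<Rightarrow> count_list w (False, l))"

text \<open>A small letter pairs only with a big letter one level higher on its left or a big letter
  of its own level on its right. Neither exists at the end of the top level.\<close>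

lemma length_filter_dpair_small:
  assumes "\<forall>x\<in>set xs. snd x \<le> m" "\<forall>y\<in>set ys. snd y < m"
  shows "length (filter (\<lambda>x. dpair x (False, m)) xs) = 0"
    "length (filter (dpair (False, m)) ys) = 0"
  using assms by (fastforce simp: dpair_def filter_empty_conv)+

lemma length_filter_dpair_big:
  shows "length (filter (\<lambda>x. dpair x (True, m)) w) = count_list w (False, m)"
    "length (filter (dpair (True, m)) w) = below_count w m"
  by (induction w; cases m; force simp: dpair_def below_count_def)+

definition splits :: "'a \<Rightarrow> 'a list \<Rightarrow> ('a list \<times> 'a list) set" where
  "splits c w = {(xs, ys). w = xs @ c # ys}"

lemma splits_Nil: "splits c [] = {}"
  by (simp add: splits_def)

lemma splits_Cons:
  "splits c (z # w) =
     (if z = c then {([], w)} else {}) \<union> (\<lambda>(xs, ys). (z # xs, ys)) ` splits c w"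
  by (auto simp: splits_def Cons_eq_append_conv)

lemma finite_splits: "finite (splits c w)"
  by (induction w) (simp_all add: splits_Nil splits_Cons)

text \<open>As the marked occurrence of \<open>c\<close> moves from right to left, the number of
  later occurrences runs once through 0, 1, 2 and so on.\<close>

lemma sum_splits:
  "(\<Sum>(xs, ys)\<in>splits c w. f (count_list ys c)) = (\<Sum>y<count_list w c. f y)"
proof (induction w)
  case (Cons z w)
  have "(\<Sum>(xs, ys)\<in>(\<lambda>(xs, ys). (z # xs, ys)) ` splits c w. f (count_list ys c)) =
      (\<Sum>(xs, ys)\<in>splits c w. f (count_list ys c))"
    by (subst sum.reindex) (auto simp: inj_on_def intro!: sum.cong)
  moreover have "([], w) \<notin> (\<lambda>(xs, ys). (z # xs, ys)) ` splits c w"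
    by auto
  ultimately show ?case
    using Cons by (auto simp: splits_Cons finite_splits add.commute)
qed (simp add: splits_Nil)

definition top_split :: "letter list \<Rightarrow> letter \<Rightarrow> letter list \<Rightarrow> bool" where
  "top_split xs z ys \<longleftrightarrow> (\<forall>x\<in>set xs. snd x \<le> snd z) \<and> (\<forall>y\<in>set ys. snd y < snd z)"

lemma top_split_exists:
  assumes "w \<noteq> []"
  shows "\<exists>xs z ys. w = xs @ z # ys \<and> top_split xs z ys"
  using assms
proof (induction w)
  case (Cons z w)
  show ?case
  proof (cases "\<forall>y\<in>set w. snd y < snd z")
    case True
    then show ?thesis by (intro exI[of _ "[]"]) (auto simp: top_split_def)
  next
    case False
    then have "w \<noteq> []" by auto
    then obtain xs z' ys where w: "w = xs @ z' # ys" "top_split xs z' ys"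
      using Cons.IH by blast
    then have "snd z \<le> snd z'"
      using False by (auto simp: top_split_def)
    then show ?thesis
      using w by (intro exI[of _ "z # xs"]) (auto simp: top_split_def)
  qed
qed simp

lemma top_split_unique:
  assumes "xs @ z # ys = xs' @ z' # ys'" "top_split xs z ys" "top_split xs' z' ys'"
  shows "xs = xs' \<and> z = z' \<and> ys = ys'"
proof -
  consider us where "xs = xs' @ us" "us @ z # ys = z' # ys'"
    | us where "xs @ us = xs'" "z # ys = us @ z' # ys'"
    using assms(1) by (auto simp: append_eq_append_conv2)
  then show ?thesis
  proof cases
    case 1
    then show ?thesis using assms(2,3) by (cases us) (auto simp: top_split_def)
  next
    case 2
    then show ?thesis using assms(2,3) by (cases us) (auto simp: top_split_def)
  qed
qed

section \<open>Unique insertion of the last top letter\<close>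

text \<open>
  Deleting the last letter of maximal level is the inverse of an insertion, so that every word
  arises from a unique insertion.
\<close>

definition insertions :: "letter list \<Rightarrow> (letter list \<times> letter \<times> letter list) set" where
  "insertions w = {(xs, z, ys). w = xs @ ys \<and> xs \<noteq> [] \<and> top_split xs z ys \<and>
     successively step (xs @ z # ys)}"

lemma words_Suc_bij:
  "bij_betw (\<lambda>(w, xs, z, ys). xs @ z # ys) (Sigma (words k) insertions) (words (Suc k))"
proof (rule bij_betwI')
  fix p p' assume "p \<in> Sigma (words k) insertions" "p' \<in> Sigma (words k) insertions"
  then show "((\<lambda>(w, xs, z, ys). xs @ z # ys) p = (\<lambda>(w, xs, z, ys). xs @ z # ys) p') = (p = p')"
    by (auto simp: insertions_def dest: top_split_unique)
next
  fix p assume "p \<in> Sigma (words k) insertions"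
  then show "(\<lambda>(w, xs, z, ys). xs @ z # ys) p \<in> words (Suc k)"
    by (auto simp: insertions_def words_def)
next
  fix c assume c: "c \<in> words (Suc k)"
  then have "c \<noteq> []" by (auto simp: words_def)
  then obtain xs z ys where s: "c = xs @ z # ys" "top_split xs z ys"
    using top_split_exists by blast
  \<comment> \<open>The sentinel is not the deleted letter: it has level 0, and any letter after it
    would need a lower level.\<close>
  have xs: "xs \<noteq> []"
  proof
    assume "xs = []"
    then have "z = (True, 0)" "ys \<noteq> []" using c s(1) by (auto simp: words_def)
    then show False using s(2) by (cases ys) (auto simp: top_split_def)
  qed
  \<comment> \<open>A step rises by at most one level and \<open>hd ys\<close> lies strictly below
    \<open>z\<close>, so \<open>hd ys\<close> does not lie above \<open>last xs\<close>.\<close>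
  have "step (last xs) (hd ys)" if "ys \<noteq> []"
  proof -
    have 1: "step (last xs) z" "step z (hd ys)" "snd (hd ys) < snd z"
      using c s xs that by (auto simp: words_def successively_append_iff successively_Cons top_split_def)
    then show ?thesis by (auto simp: step_def)
  qed
  then have "(xs @ ys, xs, z, ys) \<in> Sigma (words k) insertions"
    using c s xs
    by (auto simp: words_def insertions_def successively_append_iff successively_Cons)
  then show "\<exists>p\<in>Sigma (words k) insertions. c = (\<lambda>(w, xs, z, ys). xs @ z # ys) p"
    using s(1) by force
qed

text \<open>The new letter must become the last one of maximal level, which forces its level to be
  \<open>m\<close> or \<open>Suc m\<close>. The step into it then determines the admissible places:
  after \<open>T\<close>, or as a big letter directly after a small letter one level lower.\<close>

lemma insertions_eq:
  assumes w: "w = XS @ T # YS" "top_split XS T YS" and w': "successively step w" "hd w = (True, 0)"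
    and m: "m = snd T"
  shows "insertions w =
    {(XS @ [T], (False, m), YS), (XS @ [T], (True, m), YS)} \<union>
    (case m of 0 \<Rightarrow> {} | Suc l \<Rightarrow>
      (\<lambda>(us, ys). (XS @ T # us @ [(False, l)], (True, m), ys)) ` splits (False, l) YS) \<union>
    (\<lambda>(xs, ys). (xs @ [(False, m)], (True, Suc m), ys)) ` splits (False, m) w" (is "_ = ?R")
proof (intro equalityI subsetI)
  fix p assume "p \<in> insertions w"
  then obtain xs z ys where p: "p = (xs, z, ys)" and xy: "w = xs @ ys" "xs \<noteq> []"
    and t: "top_split xs z ys" and st: "step (last xs) z"
    by (auto simp: insertions_def successively_append_iff)
  have le: "snd x \<le> m" if "x \<in> set w" for x
    using that w m by (auto simp: top_split_def)
  have l: "last xs \<in> set xs" using xy by simp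
  then have "snd (last xs) \<le> m" using le xy by simp
  moreover have "m \<le> snd z"
    using t w(1) xy m by (metis Un_iff in_set_conv_decomp less_imp_le set_append top_split_def)
  ultimately consider "snd z = m" | "last xs = (False, m)" "z = (True, Suc m)"
    using st by (cases "snd z = m") (auto simp: step_def prod_eq_iff)
  then show "p \<in> ?R"
  proof cases
    case 1
    \<comment> \<open>A new letter of level \<open>m\<close> has only lower letters on its right, so
      it lies to the right of \<open>T\<close>.\<close>
    have "T \<notin> set ys" using t 1 m by (auto simp: top_split_def)
    then obtain us where us: "xs = XS @ T # us" "YS = us @ ys"
      using w(1) xy(1) by (auto simp: append_eq_append_conv2 append_eq_Cons_conv)
    show ?thesis
    proof (cases "us = []")
      case True
      then show ?thesis using p us 1 by (cases z; cases "fst z") auto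
    next
      case False
      have "last us \<in> set YS" using us False by simp
      then have "snd (last us) < m" using w(2) m by (auto simp: top_split_def)
      then have *: "m = Suc (snd (last us))" "last us = (False, snd (last us))" "z = (True, m)"
        using st us 1 False by (cases "last us"; cases z; auto simp: step_def)+
      define l where "l = snd (last us)"
      obtain vs where vs: "us = vs @ [(False, l)]"
        using False *(2) unfolding l_def by (metis append_butlast_last_id)
      then have "(vs, ys) \<in> splits (False, l) YS"
        using us by (simp add: splits_def)
      then have "p \<in> (\<lambda>(us, ys). (XS @ T # us @ [(False, l)], (True, m), ys)) ` splits (False, l) YS"
        by (rule rev_image_eqI) (simp add: p us(1) vs *(3))
      moreover have "m = Suc l" using *(1) by (simp add: l_def)
      ultimately show ?thesis by simp
    qed
  next
    case 2
    then obtain vs where vs: "xs = vs @ [(False, m)]"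
      using xy(2) by (metis append_butlast_last_id)
    then have "(vs, ys) \<in> splits (False, m) w"
      using xy by (simp add: splits_def)
    then have "p \<in> (\<lambda>(xs, ys). (xs @ [(False, m)], (True, Suc m), ys)) ` splits (False, m) w"
      by (rule rev_image_eqI) (simp add: p vs 2(2))
    then show ?thesis by blast
  qed
next
  \<comment> \<open>Only the step into \<open>z\<close> has to be checked; the step out of it goes
    down by \<open>top_split\<close>.\<close>
  have ins: "(xs, z, ys) \<in> insertions w"
    if "w = xs @ ys" "xs \<noteq> []" "top_split xs z ys" "step (last xs) z" for xs z ys
    using that w'(1)
    by (cases ys) (auto simp: insertions_def successively_append_iff top_split_def step_def)
  fix p assume "p \<in> ?R"
  then consider b where "p = (XS @ [T], (b, m), YS)"
    | l us ys where "m = Suc l" "YS = us @ (False, l) # ys" "p = (XS @ T # us @ [(False, l)], (True, m), ys)"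
    | xs ys where "w = xs @ (False, m) # ys" "p = (xs @ [(False, m)], (True, Suc m), ys)"
    by (cases m) (auto simp: splits_def)
  then show "p \<in> insertions w"
  proof cases
    case 1
    show ?thesis
      unfolding 1 by (rule ins) (use w m in \<open>auto simp: top_split_def step_def\<close>)
  next
    case 2
    have "\<forall>u\<in>set YS. snd u \<le> m"
      using w(2) m by (simp add: top_split_def less_imp_le)
    then show ?thesis
      unfolding 2(3) by (intro ins) (use 2 w m in \<open>auto simp: top_split_def step_def\<close>)
  next
    case 3
    have "\<forall>x\<in>set w. snd x \<le> m"
      using w m by (auto simp: top_split_def)
    then show ?thesis
      unfolding 3(2) by (intro ins) (use 3(1) in \<open>auto simp: top_split_def step_def less_Suc_eq_le le_SucI\<close>)
  qed
qed

lemma finite_insertions: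
  assumes "w \<in> words k"
  shows "finite (insertions w)"
proof -
  have w: "w \<noteq> []" "successively step w" "hd w = (True, 0)" using assms by (auto simp: words_def)
  then obtain xs z ys where s: "w = xs @ z # ys" "top_split xs z ys"
    using top_split_exists by blast
  show ?thesis
    unfolding insertions_eq[OF s w(2,3) refl] by (auto simp: finite_splits split: nat.splits)
qed

lemma words_0: "words 0 = {[(True, 0)]}"
  by (auto simp: words_def length_Suc_conv)

lemma finite_words: "finite (words k)"
proof (induction k)
  case (Suc k)
  then have "finite (Sigma (words k) insertions)"
    using finite_insertions by blast
  then show ?case
    using bij_betw_finite[OF words_Suc_bij] by blast
qed (simp add: words_0)

lemma sum_insertions:
  assumes w: "w = XS @ T # YS" "top_split XS T YS" and w': "successively step w" "hd w = (True, 0)"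
    and m: "m = snd T"
  shows "(\<Sum>(xs, z, ys)\<in>insertions w. f xs z ys) =
    f (XS @ [T]) (False, m) YS + f (XS @ [T]) (True, m) YS +
    (case m of 0 \<Rightarrow> 0 | Suc l \<Rightarrow>
      \<Sum>(us, ys)\<in>splits (False, l) YS. f (XS @ T # us @ [(False, l)]) (True, m) ys) +
    (\<Sum>(xs, ys)\<in>splits (False, m) w. f (xs @ [(False, m)]) (True, Suc m) ys)"
proof -
  let ?A = "{(XS @ [T], (False, m), YS), (XS @ [T], (True, m), YS)}"
  let ?B = "case m of 0 \<Rightarrow> {} | Suc l \<Rightarrow>
      (\<lambda>(us, ys). (XS @ T # us @ [(False, l)], (True, m), ys)) ` splits (False, l) YS"
  let ?C = "(\<lambda>(xs, ys). (xs @ [(False, m)], (True, Suc m), ys)) ` splits (False, m) w"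
  let ?f = "\<lambda>(xs, z, ys). f xs z ys"
  have fin: "finite ?A" "finite ?B" "finite ?C"
    by (auto simp: finite_splits split: nat.splits)
  have dis: "?A \<inter> ?B = {}" "(?A \<union> ?B) \<inter> ?C = {}"
    by (auto split: nat.splits)
  have "sum ?f ?B = (case m of 0 \<Rightarrow> 0 | Suc l \<Rightarrow>
      \<Sum>(us, ys)\<in>splits (False, l) YS. f (XS @ T # us @ [(False, l)]) (True, m) ys)"
  proof (cases m)
    case (Suc l)
    show ?thesis
      unfolding Suc nat.case by (subst sum.reindex) (auto simp: inj_on_def intro!: sum.cong)
  qed simp
  moreover have "sum ?f ?C =
      (\<Sum>(xs, ys)\<in>splits (False, m) w. f (xs @ [(False, m)]) (True, Suc m) ys)"
    by (subst sum.reindex) (auto simp: inj_on_def intro!: sum.cong)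
  moreover have "sum ?f (insertions w) = sum ?f ?A + sum ?f ?B + sum ?f ?C"
    unfolding insertions_eq[OF assms]
    using sum.union_disjoint[OF _ fin(3) dis(2), of ?f] sum.union_disjoint[OF fin(1,2) dis(1), of ?f] fin(1,2)
    by (simp only: finite_UnI)
  moreover have "sum ?f ?A = f (XS @ [T]) (False, m) YS + f (XS @ [T]) (True, m) YS"
    by simp
  ultimately show ?thesis by (simp only:)
qed

section \<open>The potential of a partial word and its conservation\<close>

definition top_level :: "letter list \<Rightarrow> nat" where
  "top_level w = Max (snd ` set w)"

text \<open>The state \<open>y\<close> of a partial word: the scan from the right ends at the last
  top letter, and the small letters counted are those after which a big letter of the top level can
  still be inserted.\<close>

definition free_slots :: "letter list \<Rightarrow> nat" where
  "free_slots w = below_count (rev (takeWhile (\<lambda>z. snd z < top_level w) (rev w))) (top_level w)"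

lemma top_split_state:
  assumes "top_split xs z ys"
  shows "top_level (xs @ z # ys) = snd z"
    "free_slots (xs @ z # ys) = below_count ys (snd z)"
proof -
  show 1: "top_level (xs @ z # ys) = snd z"
    using assms unfolding top_level_def
    by (intro Max_eqI) (auto simp: top_split_def less_imp_le)
  have "takeWhile (\<lambda>u. snd u < snd z) (rev ys @ z # rev xs) = rev ys"
    using assms by (subst takeWhile_append2) (auto simp: top_split_def)
  then show "free_slots (xs @ z # ys) = below_count ys (snd z)"
    unfolding free_slots_def 1 by simp
qed

text \<open>The expected generating function of the completions of \<open>w\<close>. The sentinel
  counts as a big letter of level 0, hence \<open>Suc b\<close> and \<open>Suc s\<close>.\<close>

definition potential :: "nat \<Rightarrow> nat \<Rightarrow> nat \<Rightarrow> letter list \<Rightarrow> int poly fract" where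
  "potential a b s w = completions (top_level w) (count_list w (False, top_level w)) (free_slots w)
     (int a - int (length (filter (\<lambda>z. \<not> fst z) w)))
     (int (Suc b) - int (length (filter fst w)))
     (int (Suc s) - int (count_list w (True, 0)))"

lemma potential_insert:
  assumes "w = xs @ ys" "top_split xs z ys"
  shows "potential a b s (xs @ z # ys) = completions (snd z)
     (count_list w (False, snd z) + of_bool (\<not> fst z)) (below_count ys (snd z))
     (int a - int (length (filter (\<lambda>z. \<not> fst z) w)) - of_bool (\<not> fst z))
     (int (Suc b) - int (length (filter fst w)) - of_bool (fst z))
     (int (Suc s) - int (count_list w (True, 0)) - of_bool (fst z \<and> snd z = 0))"
  unfolding potential_def top_split_state[OF assms(2)] using assms(1)
  by (cases z; cases "fst z") (simp_all add: algebra_simps)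

text \<open>The kinds of insertion in \<open>insertions_eq\<close> match the summands of
  \<open>completions_rec\<close>, with the change of weight as coefficient.\<close>

lemma sum_insertions_potential:
  assumes w: "w \<in> words k" and k: "k < a + b"
  shows "(\<Sum>(xs, z, ys)\<in>insertions w. weight (xs @ z # ys) * potential a b s (xs @ z # ys)) =
    weight w * potential a b s w"
proof -
  have w': "w \<noteq> []" "successively step w" "hd w = (True, 0)" "length w = Suc k"
    using assms by (auto simp: words_def)
  then obtain XS T YS where s: "w = XS @ T # YS" "top_split XS T YS"
    using top_split_exists by blast
  define m x y where "m = snd T" and "x = count_list w (False, m)" and "y = below_count YS m"
  define A B S where "A = int a - int (length (filter (\<lambda>z. \<not> fst z) w))"
    and "B = int (Suc b) - int (length (filter fst w))"
    and "S = int (Suc s) - int (count_list w (True, 0))"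
  have YS: "\<forall>u\<in>set YS. snd u < m" and XS: "\<forall>u\<in>set XS. snd u \<le> m"
    using s(2) by (auto simp: top_split_def m_def)
  have YS': "\<forall>u\<in>set YS. snd u \<le> m"
    using YS by (simp add: less_imp_le)
  have cw: "count_list w (c, Suc m) = 0" for c
  proof -
    have "\<forall>u\<in>set w. snd u \<le> m" using s(1) XS YS m_def by auto
    then show ?thesis by (fastforce simp: count_list_0_iff)
  qed
  have pw: "potential a b s w = completions m x y A B S"
    using top_split_state[OF s(2)] by (simp add: potential_def s(1) m_def x_def y_def A_def B_def S_def)
  have "length (filter (\<lambda>z. \<not> fst z) w) + length (filter fst w) = Suc k"
    using sum_length_filter_compl[of fst w] w'(4) by simp
  then have pos: "A + B > 0"
    using k by (simp add: A_def B_def)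
  have y0: "m = 0 \<longrightarrow> y = 0" by (simp add: y_def below_count_def)
  let ?g = "\<lambda>xs z ys. weight (xs @ z # ys) * potential a b s (xs @ z # ys)"
  have small: "?g (XS @ [T]) (False, m) YS = weight w * (completions m (Suc x) y (A - 1) B S / q ^ m)"
  proof -
    have ws: "w = (XS @ [T]) @ YS" using s(1) by simp
    have t: "top_split (XS @ [T]) (False, m) YS"
      using XS YS by (auto simp: top_split_def m_def)
    have "length (filter (\<lambda>x. dpair x (False, m)) (XS @ [T])) = 0"
      "length (filter (dpair (False, m)) YS) = 0"
      by (rule length_filter_dpair_small[of "XS @ [T]" m YS]; use XS YS m_def in auto)+
    then have "weight ((XS @ [T]) @ (False, m) # YS) = weight w / q ^ m"
      unfolding weight_insert using s(1) by simp
    moreover have "potential a b s ((XS @ [T]) @ (False, m) # YS) = completions m (Suc x) y (A - 1) B S"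
      by (subst potential_insert[OF ws t]) (simp add: x_def y_def A_def B_def S_def)
    ultimately show ?thesis by simp
  qed
  have big: "?g xs (True, m) ys = weight w * (q ^ (x + y') / q ^ m *
      completions m x y' A (B - 1) (S - of_bool (m = 0)))"
    if "w = xs @ ys" "top_split xs (True, m) ys" "below_count ys m = y'"
    for xs ys y'
  proof -
    \<comment> \<open>All \<open>x\<close> small letters of level \<open>m\<close> thus lie to the
      left of the new big letter and pair with it.\<close>
    have z: "count_list ys (False, m) = 0"
      using that(2) by (auto simp: top_split_def count_list_0_iff)
    have "weight (xs @ (True, m) # ys) = weight w * (q ^ (x + y') / q ^ m)"
      unfolding weight_insert length_filter_dpair_big
      using that z by (simp add: x_def)
    moreover have "potential a b s (xs @ (True, m) # ys) =
        completions m x y' A (B - 1) (S - of_bool (m = 0))"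
      using that(3) by (subst potential_insert[OF that(1,2)]) (simp add: x_def A_def B_def S_def)
    ultimately show ?thesis by simp
  qed
  have big1: "?g (XS @ [T]) (True, m) YS = weight w * (q ^ (x + y) / q ^ m *
      completions m x y A (B - 1) (S - of_bool (m = 0)))"
    using s XS YS by (intro big) (auto simp: top_split_def m_def y_def)
  have big2: "(case m of 0 \<Rightarrow> 0 | Suc l \<Rightarrow>
      \<Sum>(us, ys)\<in>splits (False, l) YS. ?g (XS @ T # us @ [(False, l)]) (True, m) ys) =
    weight w * (\<Sum>y'<y. q ^ (x + y') / q ^ m * completions m x y' A (B - 1) (S - of_bool (m = 0)))"
  proof (cases m)
    case 0
    then show ?thesis using y0 by simp
  next
    case (Suc l)
    have "?g (XS @ T # us @ [(False, l)]) (True, m) ys = weight w * (q ^ (x + count_list ys (False, l)) / q ^ m *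
        completions m x (count_list ys (False, l)) A (B - 1) (S - of_bool (m = 0)))"
      if "(us, ys) \<in> splits (False, l) YS" for us ys
    proof (rule big)
      show "below_count ys m = count_list ys (False, l)"
        by (simp add: Suc below_count_def)
      show "w = (XS @ T # us @ [(False, l)]) @ ys"
        using that s(1) by (simp add: splits_def)
      show "top_split (XS @ T # us @ [(False, l)]) (True, m) ys"
        using that XS YS YS' m_def by (auto simp: top_split_def splits_def)
    qed
    then have "(\<Sum>(us, ys)\<in>splits (False, l) YS. ?g (XS @ T # us @ [(False, l)]) (True, m) ys) =
      (\<Sum>(us, ys)\<in>splits (False, l) YS. weight w * (q ^ (x + count_list ys (False, l)) / q ^ m *
        completions m x (count_list ys (False, l)) A (B - 1) (S - of_bool (m = 0))))"
      by (intro sum.cong) auto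
    also have "\<dots> = (\<Sum>y'<y. weight w * (q ^ (x + y') / q ^ m *
        completions m x y' A (B - 1) (S - of_bool (m = 0))))"
      by (subst sum_splits) (simp add: y_def Suc below_count_def)
    finally show ?thesis by (simp add: Suc sum_distrib_left)
  qed
  have big3: "(\<Sum>(xs, ys)\<in>splits (False, m) w. ?g (xs @ [(False, m)]) (True, Suc m) ys) =
    weight w * (\<Sum>y'<x. q ^ y' / q ^ Suc m * completions (Suc m) 0 y' A (B - 1) S)"
  proof -
    have "?g (xs @ [(False, m)]) (True, Suc m) ys = weight w * (q ^ count_list ys (False, m) / q ^ Suc m *
        completions (Suc m) 0 (count_list ys (False, m)) A (B - 1) S)"
      if "(xs, ys) \<in> splits (False, m) w" for xs ys
    proof -
      have w: "w = (xs @ [(False, m)]) @ ys" using that by (simp add: splits_def)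
      have "\<forall>x\<in>set w. snd x \<le> m"
        using s(1) XS YS m_def by auto
      then have t: "top_split (xs @ [(False, m)]) (True, Suc m) ys"
        using w by (simp add: top_split_def le_SucI less_Suc_eq_le)
      have "count_list xs (False, Suc m) = 0"
        using cw[of False] w by auto
      then have "weight ((xs @ [(False, m)]) @ (True, Suc m) # ys) =
          weight w * (q ^ count_list ys (False, m) / q ^ Suc m)"
        unfolding weight_insert length_filter_dpair_big using w by (simp add: below_count_def)
      moreover have "potential a b s ((xs @ [(False, m)]) @ (True, Suc m) # ys) =
          completions (Suc m) 0 (count_list ys (False, m)) A (B - 1) S"
        using cw[of False]
        by (subst potential_insert[OF w t]) (simp add: A_def B_def S_def below_count_def)
      ultimately show ?thesis by simp
    qed
    then have "(\<Sum>(xs, ys)\<in>splits (False, m) w. ?g (xs @ [(False, m)]) (True, Suc m) ys) =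
      (\<Sum>(xs, ys)\<in>splits (False, m) w. weight w * (q ^ count_list ys (False, m) / q ^ Suc m *
        completions (Suc m) 0 (count_list ys (False, m)) A (B - 1) S))"
      by (intro sum.cong) auto
    also have "\<dots> = (\<Sum>y'<x. weight w * (q ^ y' / q ^ Suc m *
        completions (Suc m) 0 y' A (B - 1) S))"
      by (subst sum_splits) (simp add: x_def)
    finally show ?thesis by (simp add: sum_distrib_left)
  qed
  \<comment> \<open>Insertion directly after \<open>T\<close> gives \<open>y' = y\<close>;
    insertions after a lower small letter give each \<open>y' < y\<close> once.\<close>
  have "(\<Sum>y'\<le>y. f y') = f y + (\<Sum>y'<y. f y')" for f :: "nat \<Rightarrow> int poly fract"
    by (simp add: add.commute flip: lessThan_Suc_atMost)
  then show ?thesis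
    unfolding sum_insertions[OF s w'(2,3) m_def] small big1 big2 big3 pw
    by (subst completions_rec[OF pos y0]) (simp add: distrib_left)
qed

text \<open>The sum of weight times potential over \<open>words k\<close> is constant for
  \<open>k \<le> a + b\<close>. At \<open>k = 0\<close> only the sentinel remains; at
  \<open>k = a + b\<close> the potential is the indicator of the prescribed counts.\<close>

lemma sum_words_weight:
  "(\<Sum>w | w \<in> words (a + b) \<and> length (filter (\<lambda>z. \<not> fst z) w) = a \<and> count_list w (True, 0) = Suc s. weight w) =
    completions 0 0 0 (int a) (int b) (int s)"
proof -
  let ?T = "\<lambda>k. \<Sum>w\<in>words k. weight w * potential a b s w"
  have "?T (Suc k) = ?T k" if "k < a + b" for k
  proof -
    have "?T (Suc k) = (\<Sum>(w, xs, z, ys)\<in>Sigma (words k) insertions.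
        weight (xs @ z # ys) * potential a b s (xs @ z # ys))"
      by (subst sum.reindex_bij_betw[OF words_Suc_bij, symmetric]) (simp add: case_prod_unfold)
    also have "\<dots> = (\<Sum>w\<in>words k. \<Sum>(xs, z, ys)\<in>insertions w.
        weight (xs @ z # ys) * potential a b s (xs @ z # ys))"
      by (subst sum.Sigma) (auto simp: finite_words finite_insertions)
    finally show ?thesis
      using that by (simp add: sum_insertions_potential)
  qed
  then have const: "k \<le> a + b \<Longrightarrow> ?T k = ?T 0" for k
    by (induction k) auto
  have "?T (a + b) = ?T 0" by (rule const) simp
  also have "\<dots> = completions 0 0 0 (int a) (int b) (int s)"
    by (simp add: words_0 potential_def weight_def top_level_def free_slots_def below_count_def)
  also have "?T (a + b) = (\<Sum>w\<in>words (a + b). if length (filter (\<lambda>z. \<not> fst z) w) = a \<and>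
      count_list w (True, 0) = Suc s then weight w else 0)"
  proof (rule sum.cong)
    fix w assume "w \<in> words (a + b)"
    then have "length (filter (\<lambda>z. \<not> fst z) w) + length (filter fst w) = Suc (a + b)"
      using sum_length_filter_compl[of fst w] by (simp add: words_def)
    then show "weight w * potential a b s w = (if length (filter (\<lambda>z. \<not> fst z) w) = a \<and>
      count_list w (True, 0) = Suc s then weight w else 0)"
      unfolding potential_def by (subst completions_done) auto
  qed simp
  finally show ?thesis
    by (simp only: sum.inter_filter[OF finite_words])
qed

section \<open>Parking functions as words\<close>

definition before :: "nat list \<Rightarrow> nat \<Rightarrow> nat \<Rightarrow> bool" where
  "before u i j \<longleftrightarrow> u ! j < u ! i \<or> u ! i = u ! j \<and> j < i"

lemma before_irrefl [simp]: "\<not> before u i i"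
  by (simp add: before_def)

lemma before_asym: "before u i j \<Longrightarrow> \<not> before u j i"
  by (auto simp: before_def)

lemma before_trans: "before u i j \<Longrightarrow> before u j k \<Longrightarrow> before u i k"
  by (auto simp: before_def)

lemma before_total: "i \<noteq> j \<Longrightarrow> before u i j \<or> before u j i"
  by (auto simp: before_def)

lemma sorted_wrt_insort_key_stable:
  fixes f :: "'a::linorder \<Rightarrow> 'b::linorder"
  assumes "sorted_wrt (\<lambda>i j. f i < f j \<or> f i = f j \<and> i < j) xs" "\<forall>y\<in>set xs. x < y"
  shows "sorted_wrt (\<lambda>i j. f i < f j \<or> f i = f j \<and> i < j) (insort_key f x xs)"
  using assms by (induction xs) (auto simp: set_insort_key)

lemma sorted_wrt_sort_key_stable:
  fixes f :: "'a::linorder \<Rightarrow> 'b::linorder"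
  assumes "sorted_wrt (<) xs"
  shows "sorted_wrt (\<lambda>i j. f i < f j \<or> f i = f j \<and> i < j) (sort_key f xs)"
  using assms
proof (induction xs)
  case (Cons x xs)
  then show ?case using sorted_wrt_insort_key_stable[of f "sort_key f xs" x] by simp
qed simp

lemma sorted_wrt_before:
  "sorted_wrt (before u) (rev (sort_key (\<lambda>i. u ! i) [0..<length u]))"
proof -
  have "sorted_wrt (\<lambda>i j. u ! i < u ! j \<or> u ! i = u ! j \<and> i < j) (sort_key (\<lambda>i. u ! i) [0..<length u])"
    by (rule sorted_wrt_sort_key_stable) simp
  then show ?thesis
    unfolding sorted_wrt_rev by (rule sorted_wrt_mono_rel[rotated]) (auto simp: before_def)
qed

lemma sorted_wrt_filter_iff:
  "sorted_wrt R (filter P xs) \<longleftrightarrow> sorted_wrt (\<lambda>x y. P x \<and> P y \<longrightarrow> R x y) xs"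
  by (induction xs) auto

text \<open>Asymmetry makes \<open>B i j\<close> equivalent, for entries of the list, to
  \<open>i\<close> standing before \<open>j\<close>.\<close>

lemma sorted_wrt_iff_of_asym:
  assumes "sorted_wrt B xs" "\<And>i j. B i j \<Longrightarrow> \<not> B j i"
  shows "sorted_wrt Q xs \<longleftrightarrow> (\<forall>i\<in>set xs. \<forall>j\<in>set xs. B i j \<longrightarrow> Q i j)"
proof -
  have "\<not> B i i" for i using assms(2) by blast
  then show ?thesis
    using assms(1) by (induction xs) (auto dest: assms(2))
qed

text \<open>Every word is a shuffle of its small and its big part. If these are increasing, their
  sets determine them as the two intervals.\<close>

lemma in_shuffles_upt_iff:
  assumes W: "distinct W" "set W = {1..a + b}"
  shows "W \<in> shuffles [1..<a + 1] [a + 1..<a + b + 1] \<longleftrightarrow>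
    sorted_wrt (\<lambda>x y. (a < x \<longleftrightarrow> a < y) \<longrightarrow> x < y) W"
proof
  let ?L = "[1..<a + 1]" and ?R = "[a + 1..<a + b + 1]"
  assume sh: "W \<in> shuffles ?L ?R"
  have dis: "set ?L \<inter> set ?R = {}" by auto
  have "filter (\<lambda>x. x \<in> set ?L) W = ?L" "filter (\<lambda>x. x \<in> set ?R) W = ?R"
    using filter_shuffles_disjoint1[OF dis sh] filter_shuffles_disjoint2[OF dis sh] by auto
  then have "sorted_wrt (<) (filter (\<lambda>x. x \<in> set ?L) W)" "sorted_wrt (<) (filter (\<lambda>x. x \<in> set ?R) W)"
    by (simp_all only: sorted_wrt_upt)
  then have LR: "sorted_wrt (\<lambda>x y. x \<in> set ?L \<and> y \<in> set ?L \<longrightarrow> x < y) W"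
    "sorted_wrt (\<lambda>x y. x \<in> set ?R \<and> y \<in> set ?R \<longrightarrow> x < y) W"
    unfolding sorted_wrt_filter_iff .
  show "sorted_wrt (\<lambda>x y. (a < x \<longleftrightarrow> a < y) \<longrightarrow> x < y) W"
    unfolding sorted_wrt_iff_nth_less
  proof (intro allI impI)
    fix i j assume ij: "i < j" "j < length W" "a < W ! i \<longleftrightarrow> a < W ! j"
    then have "W ! i \<in> {1..a + b}" "W ! j \<in> {1..a + b}"
      using W(2) nth_mem[of i W] nth_mem[of j W] by auto
    then have "W ! i \<in> set ?L \<and> W ! j \<in> set ?L \<or> W ! i \<in> set ?R \<and> W ! j \<in> set ?R"
      using ij(3) by auto
    then show "W ! i < W ! j"
      using LR ij(1,2) unfolding sorted_wrt_iff_nth_less by blast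
  qed
next
  assume s: "sorted_wrt (\<lambda>x y. (a < x \<longleftrightarrow> a < y) \<longrightarrow> x < y) W"
  have "sorted_wrt (<) (filter (\<lambda>x. \<not> a < x) W)" "sorted_wrt (<) (filter (\<lambda>x. a < x) W)"
    unfolding sorted_wrt_filter_iff using s by (auto elim: sorted_wrt_mono_rel[rotated])
  then have "filter (\<lambda>x. \<not> a < x) W = [1..<a + 1]" "filter (\<lambda>x. a < x) W = [a + 1..<a + b + 1]"
    using W(2) by (auto intro!: strict_sorted_equal sorted_wrt_upt simp del: upt_Suc)
  then show "W \<in> shuffles [1..<a + 1] [a + 1..<a + b + 1]"
    using partition_in_shuffles[of W "\<lambda>x. \<not> a < x"] by simp
qed

definition ordered_cars :: "nat \<Rightarrow> nat list \<Rightarrow> nat list \<Rightarrow> bool" where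
  "ordered_cars a v u \<longleftrightarrow> (\<forall>i<length u. \<forall>j<length u.
     (a < v ! i \<longleftrightarrow> a < v ! j) \<and> before u i j \<longrightarrow> v ! i < v ! j)"

lemma diagonal_word_in_shuffles_iff:
  assumes "length u = a + b" "v \<in> permutations_of_set {1..a + b}"
  shows "diagonal_word (v, u) \<in> shuffles [1..<a + 1] [a + 1..<a + b + 1] \<longleftrightarrow> ordered_cars a v u"
proof -
  let ?\<sigma> = "rev (sort_key (\<lambda>i. u ! i) [0..<length u])"
  have v: "set v = {1..a + b}" "distinct v" "length v = a + b"
    using assms(2) by (auto simp: permutations_of_set_def length_finite_permutations_of_set)
  have "set (diagonal_word (v, u)) = (!) v ` {..<length v}"
    using assms(1) v(3) by (auto simp: diagonal_word_def)
  then have "set (diagonal_word (v, u)) = {1..a + b}"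
    using v(1) by (metis lessThan_atLeast0 list.set_map map_nth set_upt)
  moreover have "distinct (diagonal_word (v, u))"
    using assms(1) v by (auto simp: diagonal_word_def distinct_map inj_on_def nth_eq_iff_index_eq)
  ultimately have "diagonal_word (v, u) \<in> shuffles [1..<a + 1] [a + 1..<a + b + 1] \<longleftrightarrow>
      sorted_wrt (\<lambda>x y. (a < x \<longleftrightarrow> a < y) \<longrightarrow> x < y) (diagonal_word (v, u))"
    by (intro in_shuffles_upt_iff)
  also have "\<dots> \<longleftrightarrow> sorted_wrt (\<lambda>i j. (a < v ! i \<longleftrightarrow> a < v ! j) \<longrightarrow> v ! i < v ! j) ?\<sigma>"
    by (simp add: diagonal_word_def sorted_wrt_map)
  also have "\<dots> \<longleftrightarrow> ordered_cars a v u"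
    by (subst sorted_wrt_iff_of_asym[OF sorted_wrt_before before_asym])
      (auto simp: ordered_cars_def)
  finally show ?thesis .
qed

lemma ordered_cars_less_iff:
  assumes "ordered_cars a v u" "i < length u" "j < length u" "a < v ! i \<longleftrightarrow> a < v ! j"
  shows "v ! i < v ! j \<longleftrightarrow> before u i j"
  using assms before_total[of i j u] unfolding ordered_cars_def by (metis less_asym less_irrefl)

section \<open>Translation of parking functions and their statistics\<close>

definition to_word :: "nat \<Rightarrow> two_line \<Rightarrow> letter list" where
  "to_word a = (\<lambda>(v, u). (True, 0) # zip (map (\<lambda>c. a < c) v) u)"

text \<open>When \<open>u\<close> rises, the later position is read first, so cars of equal size
  would decrease there. The rise condition therefore holds exactly for a small car followed by a big
  one.\<close>

lemma parking_function_iff_word: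
  assumes "ordered_cars a v u" "length u = n" "v \<in> permutations_of_set {1..n}"
  shows "parking_function n (v, u) \<longleftrightarrow> to_word a (v, u) \<in> words n"
proof -
  have v: "length v = n"
    using assms(3) by (simp add: length_finite_permutations_of_set)
  let ?z = "\<lambda>i. (a < v ! i, u ! i)"
  have z: "zip (map (\<lambda>c. a < c) v) u = map ?z [0..<n]"
    using v assms(2) by (auto intro!: nth_equalityI)
  have key: "step (?z i) (?z (Suc i)) \<longleftrightarrow>
      u ! Suc i \<le> u ! i + 1 \<and> (u ! Suc i = u ! i + 1 \<longrightarrow> v ! i < v ! Suc i)" if "Suc i < n" for i
  proof -
    have "before u (Suc i) i" if "u ! Suc i = u ! i + 1"
      using that by (simp add: before_def)
    then have "v ! i < v ! Suc i \<longleftrightarrow> \<not> a < v ! i \<and> a < v ! Suc i" if "u ! Suc i = u ! i + 1"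
      using that ordered_cars_less_iff[OF assms(1), of "Suc i" i] \<open>Suc i < n\<close> assms(2)
      by (cases "a < v ! i \<longleftrightarrow> a < v ! Suc i") auto
    then show ?thesis by (auto simp: step_def)
  qed
  have hd: "n > 0 \<Longrightarrow> hd (map ?z [0..<n]) = ?z 0"
    by (simp add: hd_map)
  have nth: "successively step (map ?z [0..<n]) \<longleftrightarrow> (\<forall>i. Suc i < n \<longrightarrow> step (?z i) (?z (Suc i)))"
    by (simp add: successively_conv_nth)
  have "to_word a (v, u) \<in> words n \<longleftrightarrow> successively step ((True, 0) # map ?z [0..<n])"
    by (simp add: words_def to_word_def z)
  also have "\<dots> \<longleftrightarrow> (n > 0 \<longrightarrow> u ! 0 = 0) \<and> (\<forall>i. Suc i < n \<longrightarrow> step (?z i) (?z (Suc i)))"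
    unfolding successively_Cons nth using hd by (auto simp: step_def)
  also have "\<dots> \<longleftrightarrow> (n > 0 \<longrightarrow> u ! 0 = 0) \<and> (\<forall>i. Suc i < n \<longrightarrow>
      u ! Suc i \<le> u ! i + 1 \<and> (u ! Suc i = u ! i + 1 \<longrightarrow> v ! i < v ! Suc i))"
    using key by auto
  also have "\<dots> \<longleftrightarrow> (n > 0 \<longrightarrow> u ! 0 = 0) \<and> (\<forall>i. 1 \<le> i \<and> i < n \<longrightarrow>
      u ! i \<le> u ! (i - 1) + 1 \<and> (u ! i = u ! (i - 1) + 1 \<longrightarrow> v ! (i - 1) < v ! i))"
    by (metis One_nat_def Suc_le_D Suc_le_eq diff_Suc_1 zero_less_Suc)
  finally show ?thesis
    using assms by (auto simp: parking_function_def)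
qed

lemma word_dinv_conv_card:
  "word_dinv w = card {(i, j). i < j \<and> j < length w \<and> dpair (w ! i) (w ! j)}"
proof (induction w)
  case (Cons z w)
  let ?S = "{(i, j). i < j \<and> j < length w \<and> dpair (w ! i) (w ! j)}"
  let ?T = "{j. j < length w \<and> dpair z (w ! j)}"
  have "{(i, j). i < j \<and> j < length (z # w) \<and> dpair ((z # w) ! i) ((z # w) ! j)} =
      (\<lambda>j. (0, Suc j)) ` ?T \<union> map_prod Suc Suc ` ?S" (is "?L = ?R")
  proof (intro equalityI subsetI)
    fix p assume "p \<in> ?L"
    then show "p \<in> ?R"
      by (cases p; cases "fst p"; cases "snd p") (auto simp: image_iff)
  qed auto
  moreover have "finite ?S"
    by (rule finite_subset[of _ "{..<length w} \<times> {..<length w}"]) auto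
  moreover have "card ?R = card ?T + card ?S" if "finite ?S"
    using that by (subst card_Un_disjoint) (auto simp: card_image inj_on_def)
  ultimately show ?case
    using Cons by (simp add: length_filter_conv_card)
qed simp

text \<open>Two cars of equal size never form a \<open>dinv\<close> pair, because the reading order
  gives them the wrong order of labels in both cases.\<close>

lemma dinv_eq_word_dinv:
  assumes "ordered_cars a v u" "length v = length u"
  shows "dinv (v, u) = word_dinv (to_word a (v, u))"
proof -
  let ?w = "zip (map (\<lambda>c. a < c) v) u"
  let ?D1 = "{(i, j). i < j \<and> j < length u \<and> u ! i = u ! j \<and> v ! i < v ! j}"
  let ?D2 = "{(i, j). i < j \<and> j < length u \<and> u ! i = u ! j + 1 \<and> v ! i > v ! j}"
  have fin: "finite ?D1" "finite ?D2"
    by (rule finite_subset[of _ "{..<length u} \<times> {..<length u}"]; auto)+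
  have 1: "v ! i < v ! j \<longleftrightarrow> \<not> a < v ! i \<and> a < v ! j"
    if "i < j" "j < length u" "u ! i = u ! j" for i j
  proof -
    have "before u j i" using that by (simp add: before_def)
    then show ?thesis
      using ordered_cars_less_iff[OF assms(1), of j i] that
      by (cases "a < v ! i \<longleftrightarrow> a < v ! j") auto
  qed
  have 2: "v ! j < v ! i \<longleftrightarrow> a < v ! i \<and> \<not> a < v ! j"
    if "i < j" "j < length u" "u ! i = u ! j + 1" for i j
  proof -
    have "before u i j" using that by (simp add: before_def)
    then show ?thesis
      using ordered_cars_less_iff[OF assms(1), of i j] that
      by (cases "a < v ! i \<longleftrightarrow> a < v ! j") auto
  qed
  have "{(i, j). i < j \<and> j < length ?w \<and> dpair (?w ! i) (?w ! j)} = ?D1 \<union> ?D2"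
    using assms(2) by (auto simp: dpair_def 1 2)
  moreover have "?D1 \<inter> ?D2 = {}" by auto
  ultimately have "word_dinv ?w = dinv (v, u)"
    unfolding word_dinv_conv_card dinv_def using card_Un_disjoint[OF fin] by simp
  \<comment> \<open>A big letter of level 0 could only pair with a later small letter one level
    lower.\<close>
  moreover have "filter (dpair (True, 0)) ?w = []"
    by (auto simp: filter_empty_conv dpair_def)
  ultimately show ?thesis
    by (simp add: to_word_def)
qed

lemma area_eq_word:
  assumes "length v = length u"
  shows "area (v, u) = sum_list (map snd (to_word a (v, u)))"
  using assms by (simp add: area_def to_word_def)

lemma big_on_diagonal_eq_word:
  assumes "length v = length u"
  shows "Suc (big_on_diagonal a (v, u)) = count_list (to_word a (v, u)) (True, 0)"
proof -
  have "{i. i < length u \<and> u ! i = 0 \<and> v ! i > a} =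
    {i. i < length (zip (map (\<lambda>c. a < c) v) u) \<and> (True, 0) = zip (map (\<lambda>c. a < c) v) u ! i}"
    using assms by auto
  then show ?thesis
    by (simp add: big_on_diagonal_def to_word_def count_list_eq_length_filter length_filter_conv_card)
qed

lemma small_count_word:
  assumes "v \<in> permutations_of_set {1..a + b}" "length u = a + b"
  shows "length (filter (\<lambda>z. \<not> fst z) (to_word a (v, u))) = a"
proof -
  have v: "set v = {1..a + b}" "distinct v" "length v = a + b"
    using assms(1) by (auto simp: permutations_of_set_def length_finite_permutations_of_set)
  have "length (filter (\<lambda>z. \<not> fst z) (to_word a (v, u))) =
      length (filter Not (map fst (zip (map (\<lambda>c. a < c) v) u)))"
    by (simp add: to_word_def filter_map o_def)
  also have "\<dots> = length (filter (\<lambda>c. c \<le> a) v)"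
    using v(3) assms(2) by (simp add: filter_map o_def not_less)
  also have "\<dots> = card {c \<in> {1..a + b}. c \<le> a}"
    using v by (simp flip: distinct_card)
  also have "{c \<in> {1..a + b}. c \<le> a} = {1..a}"
    by auto
  finally show ?thesis by simp
qed

section \<open>Recovering the labels from sizes and levels\<close>

definition car_label :: "nat \<Rightarrow> bool list \<Rightarrow> nat list \<Rightarrow> nat \<Rightarrow> nat" where
  "car_label a c u i = Suc ((if c ! i then a else 0) +
     card {j. j < length u \<and> c ! j = c ! i \<and> before u j i})"

lemma ordered_cars_eq_label:
  assumes "ordered_cars a v u" "length u = a + b" "v \<in> permutations_of_set {1..a + b}" "i < a + b"
  shows "v ! i = car_label a (map (\<lambda>c. a < c) v) u i"
proof -
  have v: "set v = {1..a + b}" "distinct v" "length v = a + b"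
    using assms(3) by (auto simp: permutations_of_set_def length_finite_permutations_of_set)
  let ?J = "{j. j < length u \<and> map (\<lambda>c. a < c) v ! j = map (\<lambda>c. a < c) v ! i \<and> before u j i}"
  have J: "?J = {j. j < a + b \<and> (a < v ! j \<longleftrightarrow> a < v ! i) \<and> v ! j < v ! i}"
    using ordered_cars_less_iff[OF assms(1)] assms(2,4) v(3) by auto
  let ?lo = "if a < v ! i then a else 0"
  have vi: "1 \<le> v ! i" using v assms(4) by (metis atLeastAtMost_iff nth_mem)
  \<comment> \<open>The smaller labels of the same size fill an interval, so counting them
    determines \<open>v ! i\<close>.\<close>
  have img: "(!) v ` ?J = {Suc ?lo..<v ! i}"
  proof (intro equalityI subsetI)
    fix x assume "x \<in> (!) v ` ?J"
    then obtain j where j: "j < a + b" "a < v ! j \<longleftrightarrow> a < v ! i" "v ! j < v ! i" "x = v ! j"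
      unfolding J by auto
    then have "1 \<le> x" using v by (metis atLeastAtMost_iff nth_mem)
    then show "x \<in> {Suc ?lo..<v ! i}" using j by auto
  next
    fix x assume x: "x \<in> {Suc ?lo..<v ! i}"
    moreover have "v ! i \<le> a + b" using v assms(4) by (metis atLeastAtMost_iff nth_mem)
    ultimately have "x \<in> set v" using v(1) by auto
    then obtain j where "j < a + b" "x = v ! j" using v(3) by (metis in_set_conv_nth)
    then show "x \<in> (!) v ` ?J" using x unfolding J by (auto split: if_splits)
  qed
  have "inj_on ((!) v) ?J"
    using v assms(2) by (auto simp: inj_on_def nth_eq_iff_index_eq)
  from card_image[OF this] have "card ?J = v ! i - Suc ?lo"
    unfolding img by simp
  moreover have "Suc ?lo \<le> v ! i" using vi by auto
  moreover have "map (\<lambda>c. a < c) v ! i \<longleftrightarrow> a < v ! i" using assms(4) v(3) by simp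
  ultimately show ?thesis unfolding car_label_def by simp
qed

text \<open>The rank of a position within its size class is less than the class size, so the labels
  fall into the correct block. Totality of \<open>before\<close> makes them distinct.\<close>

lemma car_label_props:
  assumes c: "length c = a + b" "length (filter Not c) = a" and u: "length u = a + b"
  defines "v \<equiv> map (car_label a c u) [0..<a + b]"
  shows "v \<in> permutations_of_set {1..a + b}" "ordered_cars a v u" "map (\<lambda>x. a < x) v = c"
proof -
  let ?J = "\<lambda>i. {j. j < length u \<and> c ! j = c ! i \<and> before u j i}"
  have fin: "finite (?J i)" for i by simp
  have "length (filter (\<lambda>x. x) c) = b"
    using c sum_length_filter_compl[of "\<lambda>x. x" c] by simp
  then have cls: "card {j. j < a + b \<and> c ! j = t} = (if t then b else a)" for t
    using c by (cases t) (simp_all add: length_filter_conv_card)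
  have lt: "card (?J i) < (if c ! i then b else a)" if "i < a + b" for i
  proof -
    have "i \<notin> ?J i" "i \<in> {j. j < a + b \<and> c ! j = c ! i}" using that by simp_all
    moreover have "?J i \<subseteq> {j. j < a + b \<and> c ! j = c ! i}" by (auto simp: u)
    ultimately have "?J i \<subset> {j. j < a + b \<and> c ! j = c ! i}" by blast
    then have "card (?J i) < card {j. j < a + b \<and> c ! j = c ! i}"
      by (intro psubset_card_mono) simp_all
    then show ?thesis by (simp only: cls)
  qed
  have big: "a < car_label a c u i \<longleftrightarrow> c ! i" if "i < a + b" for i
    using lt[OF that] by (auto simp: car_label_def)
  have range: "car_label a c u i \<in> {1..a + b}" if "i < a + b" for i
    using lt[OF that] by (auto simp: car_label_def split: if_splits)
  have mono: "car_label a c u i < car_label a c u j"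
    if "c ! i = c ! j" "before u i j" "i < a + b" for i j
  proof -
    have "card (?J i) < card (?J j)"
    proof (rule psubset_card_mono[OF fin])
      show "?J i \<subset> ?J j"
      proof
        show "?J i \<subseteq> ?J j" using that before_trans[of u _ i j] by auto
        have "i \<in> ?J j" "i \<notin> ?J i" using that u by simp_all
        then show "?J i \<noteq> ?J j" by blast
      qed
    qed
    then show ?thesis using that by (simp add: car_label_def)
  qed
  show "map (\<lambda>x. a < x) v = c"
    using c(1) big by (auto simp: v_def intro!: nth_equalityI)
  show "ordered_cars a v u"
    unfolding ordered_cars_def using u big mono by (auto simp: v_def)
  have "inj_on (car_label a c u) {..<a + b}"
  proof (rule inj_onI)
    fix i j assume ij: "i \<in> {..<a + b}" "j \<in> {..<a + b}" "car_label a c u i = car_label a c u j"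
    then have "c ! i = c ! j" using big[of i] big[of j] by simp
    then show "i = j" using before_total[of i j u] mono[of i j] mono[of j i] ij by fastforce
  qed
  then have d: "distinct v"
    by (simp add: v_def distinct_map lessThan_atLeast0)
  have "set v = {1..a + b}"
  proof (rule card_subset_eq)
    show "set v \<subseteq> {1..a + b}" using range by (auto simp: v_def)
    show "card (set v) = card {1..a + b}" unfolding distinct_card[OF d] by (simp add: v_def)
  qed simp
  then show "v \<in> permutations_of_set {1..a + b}"
    using d by (simp add: permutations_of_set_def)
qed

lemma PF_set_iff:
  "(v, u) \<in> PF_set a b s \<longleftrightarrow> length u = a + b \<and> v \<in> permutations_of_set {1..a + b} \<and>
     ordered_cars a v u \<and> to_word a (v, u) \<in> words (a + b) \<and>
     count_list (to_word a (v, u)) (True, 0) = Suc s"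
proof (cases "length u = a + b \<and> v \<in> permutations_of_set {1..a + b}")
  case True
  then have "length v = length u" by (auto dest: length_finite_permutations_of_set)
  then show ?thesis
    using True parking_function_iff_word[of a v u "a + b"] diagonal_word_in_shuffles_iff[of u a b v]
      big_on_diagonal_eq_word[of v u a]
    by (auto simp: PF_set_def)
qed (auto simp: PF_set_def parking_function_def)

lemma to_word_bij:
  "bij_betw (to_word a) (PF_set a b s)
     {w. w \<in> words (a + b) \<and> length (filter (\<lambda>z. \<not> fst z) w) = a \<and> count_list w (True, 0) = Suc s}"
proof (rule bij_betwI')
  fix p p' assume pp: "p \<in> PF_set a b s" "p' \<in> PF_set a b s"
  obtain v u v' u' where [simp]: "p = (v, u)" "p' = (v', u')" by (cases p; cases p') auto
  have l: "length v = a + b" "length u = a + b" "length v' = a + b" "length u' = a + b"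
    using pp by (auto simp: PF_set_iff length_finite_permutations_of_set)
  show "(to_word a p = to_word a p') = (p = p')"
  proof
    assume "to_word a p = to_word a p'"
    then have z: "zip (map (\<lambda>c. a < c) v) u = zip (map (\<lambda>c. a < c) v') u'"
      by (simp add: to_word_def)
    have u: "u = u'" and m: "map (\<lambda>c. a < c) v = map (\<lambda>c. a < c) v'"
      using arg_cong[OF z, of "map snd"] arg_cong[OF z, of "map fst"] l by simp_all
    have "v ! i = v' ! i" if "i < a + b" for i
      using pp that ordered_cars_eq_label[of a v u b i] ordered_cars_eq_label[of a v' u' b i]
      by (simp add: PF_set_iff u m)
    then show "p = p'" using u l by (auto intro: nth_equalityI)
  qed simp
next
  fix p assume "p \<in> PF_set a b s"
  then show "to_word a p \<in> {w. w \<in> words (a + b) \<and>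
      length (filter (\<lambda>z. \<not> fst z) w) = a \<and> count_list w (True, 0) = Suc s}"
    using small_count_word by (cases p) (auto simp: PF_set_iff)
next
  fix w assume "w \<in> {w. w \<in> words (a + b) \<and>
      length (filter (\<lambda>z. \<not> fst z) w) = a \<and> count_list w (True, 0) = Suc s}"
  then have w: "w \<in> words (a + b)" "length (filter (\<lambda>z. \<not> fst z) w) = a" "count_list w (True, 0) = Suc s"
    by auto
  then obtain zs where zs: "w = (True, 0) # zs" "length zs = a + b"
    by (cases w) (auto simp: words_def)
  define c u where "c = map fst zs" and "u = map snd zs"
  define v where "v = map (car_label a c u) [0..<a + b]"
  have cu: "length c = a + b" "length (filter Not c) = a" "length u = a + b"
    using w(2) zs by (simp_all add: c_def u_def filter_map o_def)
  note props = car_label_props[OF cu, folded v_def]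
  have "to_word a (v, u) = w"
    by (simp add: to_word_def props(3) zs(1) c_def u_def zip_map_fst_snd)
  then show "\<exists>p\<in>PF_set a b s. w = to_word a p"
    using props(1,2) cu w by (intro bexI[of _ "(v, u)"]) (simp_all add: PF_set_iff)
qed

section \<open>The generating function of parking functions\<close>

lemma PF_set_weight:
  assumes "PF \<in> PF_set a b s"
  shows "q ^ (coarea PF + dinv PF) = q ^ ((a + b) choose 2) * weight (to_word a PF)"
proof -
  obtain v u where PF: "PF = (v, u)" by force
  have l: "length v = a + b" "length u = a + b" and o: "ordered_cars a v u"
    using assms by (auto simp: PF PF_set_iff length_finite_permutations_of_set)
  have "parking_function (a + b) PF" using assms by (simp add: PF_set_def)
  then have "area PF \<le> (a + b) choose 2"
    using area_le[of "a + b" PF] by (simp add: PF l)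
  then have "q ^ ((a + b) choose 2) = q ^ coarea PF * q ^ area PF"
    by (simp add: coarea_def PF l flip: power_add)
  then show ?thesis
    using dinv_eq_word_dinv[OF o] area_eq_word[of v u a] l
    by (simp add: PF weight_def power_add)
qed

lemma sum_PF_set:
  "(\<Sum>PF\<in>PF_set a b s. q ^ (coarea PF + dinv PF)) =
     q ^ ((a + b) choose 2) * completions 0 0 0 (int a) (int b) (int s)"
proof -
  have "(\<Sum>PF\<in>PF_set a b s. q ^ (coarea PF + dinv PF)) =
      q ^ ((a + b) choose 2) * (\<Sum>PF\<in>PF_set a b s. weight (to_word a PF))"
    by (simp add: PF_set_weight sum_distrib_left)
  then show ?thesis
    by (simp add: sum.reindex_bij_betw[OF to_word_bij] sum_words_weight)
qed

text \<open>Keeps the subtraction in the exponent of the theorem from truncating. Raising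
  \<open>b\<close> by one adds \<open>a\<close> on the left and \<open>a + b\<close> on the
  right.\<close>

lemma mult_le_choose_2:
  assumes "a > 0"
  shows "b * a \<le> (a + b) choose 2"
  using assms
proof (induction b)
  case (Suc b)
  have "Suc m choose 2 = (m choose 2) + m" for m
    by (simp add: numeral_2_eq_2)
  then show ?case using Suc by simp
qed simp

theorem theorem4p1:
  shows "(\<forall>a b s :: nat. a > 0 \<and> s \<le> b \<longrightarrow>
           (\<Sum>PF\<in>PF_set a b s. q ^ (coarea PF + dinv PF)) =
             q ^ (((a + b) choose 2) - (b - s) * a)
               * q_binomial (a + b) a * q_binomial (a + b - s - 1) (a - 1)
               * (q_int (s + 1) / q_int (b + 1)))
       \<and> (\<forall>b s :: nat. s \<le> b \<longrightarrow>
           (\<Sum>PF\<in>PF_set 0 b s. q ^ (coarea PF + dinv PF)) =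
             q ^ (b choose 2) * of_bool (b = s))"
proof (intro conjI allI impI)
  fix a b s :: nat assume ab: "a > 0 \<and> s \<le> b"
  have "(b - s) * a \<le> b * a" by simp
  also have "\<dots> \<le> (a + b) choose 2" using ab by (simp add: mult_le_choose_2)
  finally have "q ^ ((a + b) choose 2) = q ^ (((a + b) choose 2) - (b - s) * a) * q ^ ((b - s) * a)"
    by (simp flip: power_add)
  then show "(\<Sum>PF\<in>PF_set a b s. q ^ (coarea PF + dinv PF)) =
             q ^ (((a + b) choose 2) - (b - s) * a)
               * q_binomial (a + b) a * q_binomial (a + b - s - 1) (a - 1)
               * (q_int (s + 1) / q_int (b + 1))"
    using ab by (simp add: sum_PF_set completions_start)
next
  fix b s :: nat assume "s \<le> b"
  then show "(\<Sum>PF\<in>PF_set 0 b s. q ^ (coarea PF + dinv PF)) = q ^ (b choose 2) * of_bool (b = s)"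
    using sum_PF_set[of 0 b s] completions_start_0 by simp
qed

end
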